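(* If $X=\widetilde{\bigvee}_{j\in\mathbb{N}}X_j$ is a shrinking wedge of CW-complexes, $n\geq 2$, and $\sigma:X\to\prod_{j\in\mathbb{N}}X_j$ is the canonical embedding, then $\mathcal{W}_{2n-1}(X)\leq \ker\left(\sigma_{\#}:\pi_{2n-1}(X)\to\pi_{2n-1}\left(\prod_{j\in\mathbb{N}}X_j\right)\right)$ as subgroups of $\pi_{2n-1}(X)$.
   Context: All spaces are Hausdorff and maps are continuous and based; $\mathbb{N}=\{1,2,3,\dots\}$. Loops and infinite sums. $\Omega^m(X)=\Omega^m(X,x_0)$ is the set of maps $(I^m,\partial I^m)\to (X,x_0)$, $I=[0,1]$, identified with based maps $S^m\to X$ via a fixed homeomorphism $I^m/\partial I^m\cong S^m$; $[f]\in\pi_m(X)$ is the class of $f\in\Omega^m(X)$. $\Omega^m_{\mathbb{N}}(X,x_0)$ is the set of sequences $\{f_j\}_{j\in\mathbb{N}}$ in $\Omega^m(X,x_0)$ that converge to $x_0$: for every neighborhood $U$ of $x_0$, $\operatorname{Im}(f_j)\subseteq U$ for all but finitely many $j$. For such a sequence, $\sum_{j=1}^\infty f_j\in\Omega^m(X,x_0)$ is the map that is $f_j$ (affinely rescaled) on $\left[\frac{j-1}{j},\frac{j}{j+1}\right]\times I^{m-1}$ for each $j$ and sends $\{1\}\times I^{m-1}$ to $x_0$. Whitehead products. $a_{p,q}:S^{p+q-1}\to S^p\vee S^q$ is the standard attaching map of the $(p+q)$-cell of $S^p\times S^q$. For $f\in\Omega^p(X)$, $g\in\Omega^q(X)$,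 $[f,g]=(f\vee g)\circ a_{p,q}\in\Omega^{p+q-1}(X)$; on homotopy classes, $[[f],[g]]$ is the class of $[f,g]$. Shrinking wedges. $\widetilde{\bigvee}_{j\in \mathbb{N}}X_j$ is the one-point union of based spaces (basepoints identified to $x_0$) where $U$ is open iff $U\cap X_j$ is open in $X_j$ for all $j$ and, if $x_0\in U$, then $X_j\subseteq U$ for all but finitely many $j$. With $p_j:X\to X_j$ the canonical retractions, $\sigma(x)=(p_j(x))_{j\in\mathbb{N}}$. The group $\mathcal{W}_{2n-1}(X)$. A pair $(f,g)\in\Omega^n(X)^2$ is wedge-disjoint if there are disjoint $F,G\subseteq\mathbb{N}$ with $\operatorname{Im}(f)\subseteq\bigcup_{j\in F}X_j$ and $\operatorname{Im}(g)\subseteq\bigcup_{j\in G}X_j$. A pair $(\alpha,\beta)\in\pi_n(X)^2$ is wedge-disjoint if $\alpha=[f]$, $\beta=[g]$ for some wedge-disjoint pair $(f,g)$. For $S\subseteq\pi_m(X)$, $\llbracket S\rrbracket$ is the set of all classes $\left[\sum_{j=1}^\infty f_j\right]$ with $\{f_j\}_{j\in\mathbb{N}}\in\Omega^m_{\mathbb{N}}(X,x_0)$ and each $[f_j]$ in the subgroup $\langle S\rangle$ generated by $S$. $\mathcal{W}_{2n-1}(X)=\llbracket\{[\alpha,\beta]\in\pi_{2n-1}(X)\mid (\alpha,\beta)\in\pi_n(X)^2\text{ is wedge-disjoint}\}\rrbracket$. *)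

theory Defs
  imports "HOL-Analysis.Analysis" "HOL-Algebra.Generated_Groups"
begin

section \<open>Cubes\<close>

text \<open>A point of the cube is a function \<open>nat \<Rightarrow> real\<close> that is \<open>undefined\<close> at every index \<open>\<ge> m\<close>.\<close>

definition unit_cube :: "nat \<Rightarrow> (nat \<Rightarrow> real) topology"
  where "unit_cube m = product_topology (\<lambda>i. top_of_set {0..1}) {..<m}"

definition cube_boundary :: "nat \<Rightarrow> (nat \<Rightarrow> real) set"
  where "cube_boundary m = {s \<in> topspace (unit_cube m). \<exists>i<m. s i = 0 \<or> s i = 1}"


section \<open>CW-complexes\<close>

text \<open>
  Whitehead's definition: \<open>E\<close> is the set of open cells, \<open>d e\<close> the dimension of the cell \<open>e\<close>
  and \<open>\<Phi> e\<close> its characteristic map. The pair formed by the unit cube and its boundary serves as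
  the model of the pair formed by the closed \<open>n\<close>-disc and its bounding sphere.
\<close>

definition CW_structure ::
  "'a topology \<Rightarrow> 'a set set \<Rightarrow> ('a set \<Rightarrow> nat) \<Rightarrow> ('a set \<Rightarrow> (nat \<Rightarrow> real) \<Rightarrow> 'a) \<Rightarrow> bool"
  where "CW_structure X E d \<Phi> \<longleftrightarrow>
    Hausdorff_space X \<and>
    disjoint E \<and> \<Union>E = topspace X \<and>
    (\<forall>e\<in>E. continuous_map (unit_cube (d e)) X (\<Phi> e) \<and>
       homeomorphic_map
         (subtopology (unit_cube (d e)) (topspace (unit_cube (d e)) - cube_boundary (d e)))
         (subtopology X e) (\<Phi> e) \<and>
       (\<exists>F. finite F \<and> F \<subseteq> {e'\<in>E. d e' < d e} \<and> \<Phi> e ` cube_boundary (d e) \<subseteq> \<Union>F)) \<and>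
    (\<forall>A\<subseteq>topspace X. (\<forall>e\<in>E. closedin X (A \<inter> X closure_of e)) \<longrightarrow> closedin X A)"

definition CW_complex :: "'a topology \<Rightarrow> bool"
  where "CW_complex X \<longleftrightarrow> (\<exists>E d \<Phi>. CW_structure X E d \<Phi>)"


section \<open>Loops and homotopy groups\<close>

definition loops :: "nat \<Rightarrow> 'a topology \<Rightarrow> 'a \<Rightarrow> ((nat \<Rightarrow> real) \<Rightarrow> 'a) set"
  where "loops m X x = {f. continuous_map (unit_cube m) X f \<and> f ` cube_boundary m \<subseteq> {x}}"

text \<open>
  The values of a loop outside the cube are irrelevant: two loops that agree on the cube have
  the same class.
\<close>

definition loop_class ::
  "nat \<Rightarrow> 'a topology \<Rightarrow> 'a \<Rightarrow> ((nat \<Rightarrow> real) \<Rightarrow> 'a) \<Rightarrow> ((nat \<Rightarrow> real) \<Rightarrow> 'a) set"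
  where "loop_class m X x f =
    {g. homotopic_with (\<lambda>h. h ` cube_boundary m \<subseteq> {x}) (unit_cube m) X f g}"

definition loop_add ::
  "((nat \<Rightarrow> real) \<Rightarrow> 'a) \<Rightarrow> ((nat \<Rightarrow> real) \<Rightarrow> 'a) \<Rightarrow> (nat \<Rightarrow> real) \<Rightarrow> 'a"
  where "loop_add f g = (\<lambda>s. if s 0 \<le> 1/2 then f (s(0 := 2 * s 0)) else g (s(0 := 2 * s 0 - 1)))"

text \<open>
  As in \<^theory>\<open>HOL.Equiv_Relations\<close>, operations on classes are unions over all representatives;
  such a union is a single class because the operation respects homotopy.
  This is the \<open>m\<close>-th homotopy group only for \<open>m \<ge> 1\<close>.
\<close>

definition homotopy_group ::
  "nat \<Rightarrow> 'a topology \<Rightarrow> 'a \<Rightarrow> ((nat \<Rightarrow> real) \<Rightarrow> 'a) set monoid"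
  where "homotopy_group m X x =
    \<lparr>carrier = loop_class m X x ` loops m X x,
     mult = (\<lambda>\<alpha> \<beta>. \<Union>f\<in>\<alpha>. \<Union>g\<in>\<beta>. loop_class m X x (loop_add f g)),
     one = loop_class m X x (\<lambda>s. x)\<rparr>"

definition induced_map ::
  "nat \<Rightarrow> 'b topology \<Rightarrow> 'b \<Rightarrow> ('a \<Rightarrow> 'b) \<Rightarrow> ((nat \<Rightarrow> real) \<Rightarrow> 'a) set \<Rightarrow> ((nat \<Rightarrow> real) \<Rightarrow> 'b) set"
  where "induced_map m Y y h = (\<lambda>\<alpha>. \<Union>f\<in>\<alpha>. loop_class m Y y (h \<circ> f))"


section \<open>Infinite sums\<close>

text \<open>
  Sequences are indexed by \<open>0, 1, 2, \<dots>\<close>, so the term with index \<open>j\<close> is placed on the slab where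
  the first coordinate lies between \<open>j/(j+1)\<close> and \<open>(j+1)/(j+2)\<close>, of width \<open>1/((j+1)(j+2))\<close>.
\<close>

definition null_sequences :: "nat \<Rightarrow> 'a topology \<Rightarrow> 'a \<Rightarrow> (nat \<Rightarrow> (nat \<Rightarrow> real) \<Rightarrow> 'a) set"
  where "null_sequences m X x = {f. (\<forall>j. f j \<in> loops m X x) \<and>
    (\<forall>U. openin X U \<and> x \<in> U \<longrightarrow> (\<forall>\<^sub>\<infinity>j. f j ` topspace (unit_cube m) \<subseteq> U))}"

definition infinite_sum :: "'a \<Rightarrow> (nat \<Rightarrow> (nat \<Rightarrow> real) \<Rightarrow> 'a) \<Rightarrow> (nat \<Rightarrow> real) \<Rightarrow> 'a"
  where "infinite_sum x f = (\<lambda>s. if s 0 = 1 then x else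
    (let j = (LEAST j. s 0 \<le> real (j + 1) / real (j + 2))
     in f j (s(0 := (s 0 - real j / real (j + 1)) * (real (j + 1) * real (j + 2))))))"

definition infinite_sum_classes ::
  "nat \<Rightarrow> 'a topology \<Rightarrow> 'a \<Rightarrow> ((nat \<Rightarrow> real) \<Rightarrow> 'a) set set \<Rightarrow> ((nat \<Rightarrow> real) \<Rightarrow> 'a) set set"
  where "infinite_sum_classes m X x S =
    {loop_class m X x (infinite_sum x f) | f.
       f \<in> null_sequences m X x \<and>
       (\<forall>j. loop_class m X x (f j) \<in> generate (homotopy_group m X x) S)}"


section \<open>Whitehead products\<close>

text \<open>
  A map from the \<open>m\<close>-cube onto the boundary of the \<open>(m+1)\<close>-cube that sends the boundary of the
  \<open>m\<close>-cube to the corner \<open>(0,\<dots>,0)\<close> and is injective elsewhere; it thus identifies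
  the quotient of the \<open>m\<close>-cube by its boundary with the \<open>m\<close>-sphere.
  In centred coordinates \<open>u\<close>, with \<open>r\<close> the maximum norm of \<open>u\<close>, it is the radial projection of
  \<open>(0, (1-r) u) + (1-2r) (1,\<dots>,1)\<close> to the boundary of the cube. Along each ray
  the ratio \<open>(1-2r) / (r(1-r)) = 1/r - 1/(1-r)\<close> of the two components strictly decreases
  from \<open>\<infinity>\<close> to \<open>-\<infinity>\<close>, so every direction except \<open>-(1,\<dots>,1)\<close> occurs exactly once
  for \<open>r < 1\<close>. The map preserves orientation if the boundary of the cube is oriented by
  the outward normal first.
\<close>

definition sphere_chart :: "nat \<Rightarrow> (nat \<Rightarrow> real) \<Rightarrow> nat \<Rightarrow> real"
  where "sphere_chart m s =
    (let u = (\<lambda>i. 2 * s i - 1);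
         r = Max ((\<lambda>i. \<bar>u i\<bar>) ` {..<m});
         v = (\<lambda>i. (case i of 0 \<Rightarrow> 0 | Suc k \<Rightarrow> (1 - r) * u k) + (1 - 2 * r));
         R = Max ((\<lambda>i. \<bar>v i\<bar>) ` {..<Suc m})
     in (\<lambda>i\<in>{..<Suc m}. (1 + v i / R) / 2))"

text \<open>
  The boundary of the \<open>(p+q)\<close>-cube consists of the pairs \<open>(s, t)\<close> in the product of the \<open>p\<close>-cube and
  the \<open>q\<close>-cube with \<open>s\<close> or \<open>t\<close> in the boundary. The attaching map of the top cell of the product
  of the spheres sends \<open>(s, t)\<close> to the class of \<open>s\<close> in the \<open>p\<close>-sphere if \<open>t\<close> lies in the boundary,
  and to the class of \<open>t\<close> in the \<open>q\<close>-sphere if \<open>s\<close> does. The following is its composite with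
  the map that is \<open>f\<close> on the \<open>p\<close>-sphere and \<open>g\<close> on the \<open>q\<close>-sphere.
\<close>

definition wedge_attach ::
  "nat \<Rightarrow> nat \<Rightarrow> ((nat \<Rightarrow> real) \<Rightarrow> 'a) \<Rightarrow> ((nat \<Rightarrow> real) \<Rightarrow> 'a) \<Rightarrow> (nat \<Rightarrow> real) \<Rightarrow> 'a"
  where "wedge_attach p q f g z =
    (let s = restrict z {..<p}; t = (\<lambda>i\<in>{..<q}. z (p + i))
     in if t \<in> cube_boundary q then f s else g t)"

definition whitehead_loop ::
  "nat \<Rightarrow> nat \<Rightarrow> ((nat \<Rightarrow> real) \<Rightarrow> 'a) \<Rightarrow> ((nat \<Rightarrow> real) \<Rightarrow> 'a) \<Rightarrow> (nat \<Rightarrow> real) \<Rightarrow> 'a"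
  where "whitehead_loop p q f g = wedge_attach p q f g \<circ> sphere_chart (p + q - 1)"

definition whitehead_product ::
  "nat \<Rightarrow> nat \<Rightarrow> 'a topology \<Rightarrow> 'a \<Rightarrow> ((nat \<Rightarrow> real) \<Rightarrow> 'a) set \<Rightarrow> ((nat \<Rightarrow> real) \<Rightarrow> 'a) set \<Rightarrow>
    ((nat \<Rightarrow> real) \<Rightarrow> 'a) set"
  where "whitehead_product p q X x \<alpha> \<beta> =
    (\<Union>f\<in>\<alpha>. \<Union>g\<in>\<beta>. loop_class (p + q - 1) X x (whitehead_loop p q f g))"


section \<open>Shrinking wedges\<close>

text \<open>
  In the wedge of the spaces \<open>X j\<close> with basepoints \<open>x j\<close>, the common basepoint is \<^term>\<open>None\<close>, and
  \<^term>\<open>Some (j, a)\<close> is the point \<open>a \<noteq> x j\<close> of the \<open>j\<close>-th summand.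
\<close>

definition wedge_inj :: "(nat \<Rightarrow> 'a) \<Rightarrow> nat \<Rightarrow> 'a \<Rightarrow> (nat \<times> 'a) option"
  where "wedge_inj x j a = (if a = x j then None else Some (j, a))"

definition wedge_summand ::
  "(nat \<Rightarrow> 'a topology) \<Rightarrow> (nat \<Rightarrow> 'a) \<Rightarrow> nat \<Rightarrow> (nat \<times> 'a) option set"
  where "wedge_summand X x j = wedge_inj x j ` topspace (X j)"

definition wedge_open ::
  "(nat \<Rightarrow> 'a topology) \<Rightarrow> (nat \<Rightarrow> 'a) \<Rightarrow> (nat \<times> 'a) option set \<Rightarrow> bool"
  where "wedge_open X x U \<longleftrightarrow>
    U \<subseteq> (\<Union>j. wedge_summand X x j) \<and>
    (\<forall>j. openin (X j) {a \<in> topspace (X j). wedge_inj x j a \<in> U}) \<and>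
    (None \<in> U \<longrightarrow> (\<forall>\<^sub>\<infinity>j. wedge_summand X x j \<subseteq> U))"

definition shrinking_wedge ::
  "(nat \<Rightarrow> 'a topology) \<Rightarrow> (nat \<Rightarrow> 'a) \<Rightarrow> (nat \<times> 'a) option topology"
  where "shrinking_wedge X x = topology (wedge_open X x)"

lemma istopology_wedge_open: "istopology (wedge_open X x)"
  unfolding istopology_def
proof (intro conjI allI impI)
  fix S T assume S: "wedge_open X x S" and T: "wedge_open X x T"
  have "{a \<in> topspace (X j). wedge_inj x j a \<in> S \<inter> T} =
    {a \<in> topspace (X j). wedge_inj x j a \<in> S} \<inter> {a \<in> topspace (X j). wedge_inj x j a \<in> T}" for j
    by auto
  moreover have "\<forall>\<^sub>\<infinity>j. wedge_summand X x j \<subseteq> S \<inter> T" if "None \<in> S \<inter> T"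
    using S T that unfolding wedge_open_def by (auto elim: eventually_elim2)
  ultimately show "wedge_open X x (S \<inter> T)"
    using S T unfolding wedge_open_def by (simp add: openin_Int) blast
next
  fix K assume K: "\<forall>S\<in>K. wedge_open X x S"
  have "{a \<in> topspace (X j). wedge_inj x j a \<in> \<Union>K} =
    (\<Union>S\<in>K. {a \<in> topspace (X j). wedge_inj x j a \<in> S})" for j
    by auto
  moreover have "\<forall>\<^sub>\<infinity>j. wedge_summand X x j \<subseteq> \<Union>K" if N: "None \<in> \<Union>K"
  proof -
    obtain S where "S \<in> K" "\<forall>\<^sub>\<infinity>j. wedge_summand X x j \<subseteq> S"
      using N K unfolding wedge_open_def by auto
    then show ?thesis
      by (elim eventually_mono) auto
  qed
  moreover have "\<Union>K \<subseteq> (\<Union>j. wedge_summand X x j)"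
    using K unfolding wedge_open_def by blast
  moreover have "openin (X j) (\<Union>S\<in>K. {a \<in> topspace (X j). wedge_inj x j a \<in> S})" for j
    using K unfolding wedge_open_def by (intro openin_clauses) auto
  ultimately show "wedge_open X x (\<Union>K)"
    unfolding wedge_open_def by metis
qed

lemma openin_shrinking_wedge: "openin (shrinking_wedge X x) U \<longleftrightarrow> wedge_open X x U"
  by (simp add: shrinking_wedge_def istopology_wedge_open)

lemma topspace_shrinking_wedge: "topspace (shrinking_wedge X x) = (\<Union>j. wedge_summand X x j)"
proof -
  have "{a \<in> topspace (X j). wedge_inj x j a \<in> (\<Union>j. wedge_summand X x j)} = topspace (X j)" for j
    by (auto simp: wedge_summand_def)
  moreover have "wedge_summand X x j \<subseteq> (\<Union>j. wedge_summand X x j)" for j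
    by blast
  ultimately have "wedge_open X x (\<Union>j. wedge_summand X x j)"
    unfolding wedge_open_def by simp
  then show ?thesis
    unfolding topspace_def openin_shrinking_wedge by (auto simp: wedge_open_def)
qed

definition wedge_retraction :: "(nat \<Rightarrow> 'a) \<Rightarrow> nat \<Rightarrow> (nat \<times> 'a) option \<Rightarrow> 'a"
  where "wedge_retraction x j w =
    (case w of None \<Rightarrow> x j | Some (i, a) \<Rightarrow> if i = j then a else x j)"

definition wedge_to_product :: "(nat \<Rightarrow> 'a) \<Rightarrow> (nat \<times> 'a) option \<Rightarrow> nat \<Rightarrow> 'a"
  where "wedge_to_product x w = (\<lambda>j. wedge_retraction x j w)"


section \<open>The subgroup generated by wedge-disjoint Whitehead products\<close>

definition wedge_disjoint_loops ::
  "nat \<Rightarrow> (nat \<Rightarrow> 'a topology) \<Rightarrow> (nat \<Rightarrow> 'a) \<Rightarrow>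
    ((nat \<Rightarrow> real) \<Rightarrow> (nat \<times> 'a) option) \<Rightarrow> ((nat \<Rightarrow> real) \<Rightarrow> (nat \<times> 'a) option) \<Rightarrow> bool"
  where "wedge_disjoint_loops n X x f g \<longleftrightarrow>
    f \<in> loops n (shrinking_wedge X x) None \<and> g \<in> loops n (shrinking_wedge X x) None \<and>
    (\<exists>F G. F \<inter> G = {} \<and>
       f ` topspace (unit_cube n) \<subseteq> (\<Union>j\<in>F. wedge_summand X x j) \<and>
       g ` topspace (unit_cube n) \<subseteq> (\<Union>j\<in>G. wedge_summand X x j))"

definition wedge_disjoint_classes ::
  "nat \<Rightarrow> (nat \<Rightarrow> 'a topology) \<Rightarrow> (nat \<Rightarrow> 'a) \<Rightarrow>
    ((nat \<Rightarrow> real) \<Rightarrow> (nat \<times> 'a) option) set \<Rightarrow> ((nat \<Rightarrow> real) \<Rightarrow> (nat \<times> 'a) option) set \<Rightarrow> bool"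
  where "wedge_disjoint_classes n X x \<alpha> \<beta> \<longleftrightarrow>
    (\<exists>f g. wedge_disjoint_loops n X x f g \<and>
       \<alpha> = loop_class n (shrinking_wedge X x) None f \<and>
       \<beta> = loop_class n (shrinking_wedge X x) None g)"

definition W_group ::
  "nat \<Rightarrow> (nat \<Rightarrow> 'a topology) \<Rightarrow> (nat \<Rightarrow> 'a) \<Rightarrow> ((nat \<Rightarrow> real) \<Rightarrow> (nat \<times> 'a) option) set set"
  where "W_group n X x =
    infinite_sum_classes (2 * n - 1) (shrinking_wedge X x) None
      {whitehead_product n n (shrinking_wedge X x) None \<alpha> \<beta> | \<alpha> \<beta>. wedge_disjoint_classes n X x \<alpha> \<beta>}"

end

theory Submission
  imports Defs
begin

text \<open>
  Sums and inverses of homotopy classes may be formed along the second coordinate of the cube, and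
  there they commute with infinite sums taken along the first; hence classes of infinite sums form
  a subgroup. For the inclusion, a map into the product is null-homotopic as soon as each of its
  coordinates is. In the \<open>j\<close>-th coordinate one entry of every wedge-disjoint Whitehead product
  becomes constant, so every term of an infinite sum becomes null-homotopic. The null-homotopies of
  finitely many terms can be performed simultaneously, which leaves an infinite sum of arbitrarily
  small loops. Its image lies in a finite subcomplex, where all loops near the basepoint are
  contractible: remove the cells not containing the basepoint one by one, in order of decreasing
  dimension, pushing loops that avoid the centre of a cell radially into its boundary.
\<close>

section \<open>Maps into and out of cubes\<close>

text \<open>Null-homotopies of the single terms need not become small, so infinitely many of them
  cannot simply be performed slab by slab: the result could be discontinuous at the face where
  \<open>s 0 = 1\<close>. For this reason the tail is contracted as one loop, by one homotopy whose
  size does not matter. Accordingly the local statement about CW-complexes is weak: loops near the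
  basepoint contract somewhere in the space, and nearness refers only to a neighbourhood within a
  finite subcomplex that contains the image of the infinite sum. Compactness of that image makes the
  subcomplex finite, which permits an induction over its cells. The basepoint may be any point, not
  just a vertex, so the induction ends when a cell of top dimension contains it; loops inside that
  open cell contract along straight lines. The product asks for no uniformity over the coordinates,
  so the number of terms that are contracted separately may depend on the coordinate. The dimension
  \<open>2 * n - 1\<close> is at least 3, so there is a coordinate other than the one along which
  infinite sums are formed.\<close>

abbreviation unit_interval :: "real topology"
  where "unit_interval \<equiv> top_of_set {0..1}"

lemma topspace_unit_cube: "topspace (unit_cube m) = {..<m} \<rightarrow>\<^sub>E {0..1}"
  by (simp add: unit_cube_def)

lemma cube_boundary_subset: "cube_boundary m \<subseteq> topspace (unit_cube m)"
  by (auto simp: cube_boundary_def)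

lemma compact_space_unit_cube: "compact_space (unit_cube m)"
  by (simp add: unit_cube_def compact_space_product_topology compact_space_subtopology)

lemma unit_cube_nth: "s \<in> topspace (unit_cube m) \<Longrightarrow> i < m \<Longrightarrow> 0 \<le> s i \<and> s i \<le> 1"
  by (auto simp: topspace_unit_cube PiE_iff)

lemma unit_cube_upd:
  "s \<in> topspace (unit_cube m) \<Longrightarrow> i < m \<Longrightarrow> 0 \<le> a \<Longrightarrow> a \<le> 1 \<Longrightarrow> s(i := a) \<in> topspace (unit_cube m)"
  by (auto simp: topspace_unit_cube PiE_iff extensional_def)

lemma cube_boundary_upd:
  assumes "s \<in> cube_boundary m" "i < m" "0 \<le> a" "a \<le> 1" "s i = 0 \<or> s i = 1 \<Longrightarrow> a = 0 \<or> a = 1"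
  shows "s(i := a) \<in> cube_boundary m"
proof -
  obtain k where "s \<in> topspace (unit_cube m)" "k < m" "s k = 0 \<or> s k = 1"
    using assms(1) unfolding cube_boundary_def by auto
  then have "(s(i := a)) k = 0 \<or> (s(i := a)) k = 1" "s(i := a) \<in> topspace (unit_cube m)"
    using assms by (auto simp: unit_cube_upd)
  with \<open>k < m\<close> show ?thesis
    unfolding cube_boundary_def by blast
qed

lemma cube_boundary_face:
  assumes "s \<in> topspace (unit_cube m)" "i < m" "a = 0 \<or> a = 1"
  shows "s(i := a) \<in> cube_boundary m"
  using assms unfolding cube_boundary_def by (auto simp: unit_cube_upd)

lemma continuous_map_unit_cube:
  "continuous_map Z (unit_cube m) f \<longleftrightarrow>
    f ` topspace Z \<subseteq> extensional {..<m} \<and> (\<forall>i<m. continuous_map Z unit_interval (\<lambda>z. f z i))"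
  by (auto simp: unit_cube_def continuous_map_componentwise)

lemma continuous_map_unit_cube_nth:
  "continuous_map Z (unit_cube m) f \<Longrightarrow> i < m \<Longrightarrow> continuous_map Z euclideanreal (\<lambda>z. f z i)"
  by (auto simp: continuous_map_unit_cube continuous_map_in_subtopology)

lemma continuous_map_unit_cubeI:
  assumes "\<And>z i. z \<in> topspace Z \<Longrightarrow> i \<ge> m \<Longrightarrow> f z i = undefined"
    and "\<And>i. i < m \<Longrightarrow> continuous_map Z euclideanreal (\<lambda>z. f z i)"
    and "\<And>z i. z \<in> topspace Z \<Longrightarrow> i < m \<Longrightarrow> 0 \<le> f z i \<and> f z i \<le> 1"
  shows "continuous_map Z (unit_cube m) f"
  using assms by (auto simp: continuous_map_unit_cube continuous_map_in_subtopology extensional_def)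

lemma continuous_map_cube_upd:
  assumes "continuous_map Z (unit_cube m) f" "continuous_map Z euclideanreal a" "i < m"
    and "\<And>z. z \<in> topspace Z \<Longrightarrow> 0 \<le> a z \<and> a z \<le> 1"
  shows "continuous_map Z (unit_cube m) (\<lambda>z. (f z)(i := a z))"
proof (rule continuous_map_unit_cubeI)
  show "continuous_map Z euclideanreal (\<lambda>z. ((f z)(i := a z)) k)" if "k < m" for k
    using assms that by (cases "k = i") (auto intro: continuous_map_unit_cube_nth)
qed (use assms continuous_map_image_subset_topspace[OF assms(1)] in
      \<open>auto simp: topspace_unit_cube PiE_iff extensional_def image_subset_iff\<close>)

lemma continuous_map_pair_arg:
  assumes "continuous_map (prod_topology A B) Y h" "continuous_map Z A a" "continuous_map Z B b"
  shows "continuous_map Z Y (\<lambda>z. h (a z, b z))"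
  using continuous_map_compose[of Z "prod_topology A B" "\<lambda>z. (a z, b z)" Y h] assms
  by (simp add: continuous_map_paired o_def)

lemma continuous_map_Max:
  fixes f :: "'a \<Rightarrow> nat \<Rightarrow> real"
  assumes "\<And>i. i < m \<Longrightarrow> continuous_map Z euclideanreal (\<lambda>z. f z i)"
  shows "continuous_map Z euclideanreal (\<lambda>z. Max (f z ` {..<m}))"
proof (cases m)
  case (Suc k)
  have "continuous_map Z euclideanreal (\<lambda>z. SUP i\<in>{..<m}. f z i)"
    using assms by (intro continuous_map_Sup) auto
  then show ?thesis
  proof (rule continuous_map_eq)
    show "(SUP i\<in>{..<m}. f z i) = Max (f z ` {..<m})" for z
      by (rule cSup_eq_Max) (auto simp: Suc lessThan_empty_iff)
  qed
qed auto

section \<open>Homotopies of loops\<close>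

definition loop_homotopic ::
  "nat \<Rightarrow> 'a topology \<Rightarrow> 'a \<Rightarrow> ((nat \<Rightarrow> real) \<Rightarrow> 'a) \<Rightarrow> ((nat \<Rightarrow> real) \<Rightarrow> 'a) \<Rightarrow> bool"
  where "loop_homotopic m X x = homotopic_with (\<lambda>h. h ` cube_boundary m \<subseteq> {x}) (unit_cube m) X"

lemma loop_homotopic_iff:
  "loop_homotopic m X x f g \<longleftrightarrow>
    (\<exists>h. continuous_map (prod_topology unit_interval (unit_cube m)) X h \<and>
      (\<forall>s\<in>topspace (unit_cube m). h (0, s) = f s) \<and>
      (\<forall>s\<in>topspace (unit_cube m). h (1, s) = g s) \<and>
      (\<forall>t\<in>{0..1}. \<forall>s\<in>cube_boundary m. h (t, s) = x))"
proof -
  have *: "(\<lambda>h. h ` cube_boundary m \<subseteq> {x}) = (\<lambda>h. \<forall>s\<in>cube_boundary m. h s = x)"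
    by (auto simp: fun_eq_iff)
  show ?thesis
    unfolding loop_homotopic_def *
    by (rule homotopic_with) (use cube_boundary_subset[of m] in \<open>simp add: subset_iff\<close>)
qed

lemma loop_homotopicI:
  assumes "continuous_map (prod_topology unit_interval (unit_cube m)) X h"
    and "\<And>s. s \<in> topspace (unit_cube m) \<Longrightarrow> h (0, s) = f s"
    and "\<And>s. s \<in> topspace (unit_cube m) \<Longrightarrow> h (1, s) = g s"
    and "\<And>t s. 0 \<le> t \<Longrightarrow> t \<le> 1 \<Longrightarrow> s \<in> cube_boundary m \<Longrightarrow> h (t, s) = x"
  shows "loop_homotopic m X x f g"
  unfolding loop_homotopic_iff using assms by (intro exI[of _ h]) auto

lemma loop_homotopicE:
  assumes "loop_homotopic m X x f g"
  obtains h where "continuous_map (prod_topology unit_interval (unit_cube m)) X h"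
    and "\<And>s. s \<in> topspace (unit_cube m) \<Longrightarrow> h (0, s) = f s"
    and "\<And>s. s \<in> topspace (unit_cube m) \<Longrightarrow> h (1, s) = g s"
    and "\<And>t s. 0 \<le> t \<Longrightarrow> t \<le> 1 \<Longrightarrow> s \<in> cube_boundary m \<Longrightarrow> h (t, s) = x"
  using assms unfolding loop_homotopic_iff by force

lemma loop_homotopic_sym: "loop_homotopic m X x f g \<Longrightarrow> loop_homotopic m X x g f"
  unfolding loop_homotopic_def by (rule homotopic_with_symD)

lemma loop_homotopic_trans [trans]:
  "loop_homotopic m X x f g \<Longrightarrow> loop_homotopic m X x g h \<Longrightarrow> loop_homotopic m X x f h"
  unfolding loop_homotopic_def by (rule homotopic_with_trans)

text \<open>Reflexivity holds exactly at loops, so compatibility of an operation with homotopies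
  already contains its closure on loops. Several closure lemmas below are this special case.\<close>

lemma loop_homotopic_refl: "loop_homotopic m X x f f \<longleftrightarrow> f \<in> loops m X x"
  by (simp add: loop_homotopic_def loops_def)

lemma loop_homotopic_imp_loops:
  assumes "loop_homotopic m X x f g"
  shows "f \<in> loops m X x" "g \<in> loops m X x"
  using assms homotopic_with_imp_continuous_maps homotopic_with_imp_property
  unfolding loop_homotopic_def loops_def by blast+

lemma loop_homotopic_equal:
  assumes "f \<in> loops m X x" "\<And>s. s \<in> topspace (unit_cube m) \<Longrightarrow> f s = g s"
  shows "loop_homotopic m X x f g"
proof -
  have "g ` cube_boundary m = f ` cube_boundary m"
    using assms(2) cube_boundary_subset by (intro image_cong) (auto simp: subset_iff)
  then show ?thesis
    using assms unfolding loop_homotopic_def loops_def by (auto intro!: homotopic_with_equal)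
qed

lemma loop_homotopic_compose:
  assumes "loop_homotopic m X x f g" "continuous_map X Y h"
  shows "loop_homotopic m Y (h x) (h \<circ> f) (h \<circ> g)"
  using assms unfolding loop_homotopic_def
  by (rule homotopic_with_compose_continuous_map_left) auto

lemma loops_continuous: "f \<in> loops m X x \<Longrightarrow> continuous_map (unit_cube m) X f"
  by (simp add: loops_def)

lemma loops_boundary: "f \<in> loops m X x \<Longrightarrow> s \<in> cube_boundary m \<Longrightarrow> f s = x"
  by (auto simp: loops_def)

lemma loops_const: "x \<in> topspace X \<Longrightarrow> (\<lambda>s. x) \<in> loops m X x"
  by (auto simp: loops_def)

lemma loops_compose: "f \<in> loops m X x \<Longrightarrow> continuous_map X Y h \<Longrightarrow> h \<circ> f \<in> loops m Y (h x)"
  using loop_homotopic_compose loop_homotopic_refl by metis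

lemma mem_loop_class: "g \<in> loop_class m X x f \<longleftrightarrow> loop_homotopic m X x f g"
  by (simp add: loop_class_def loop_homotopic_def)

lemma loop_class_eq_iff:
  assumes "f \<in> loops m X x"
  shows "loop_class m X x f = loop_class m X x g \<longleftrightarrow> loop_homotopic m X x f g"
  using assms loop_homotopic_sym loop_homotopic_trans loop_homotopic_refl
  unfolding set_eq_iff mem_loop_class by metis

section \<open>Reparametrisation of one coordinate\<close>

text \<open>The map \<open>\<rho> (t, _)\<close> has to send end points to end points but may
  exchange or identify them. This admits reversals and folds of the interval, so unit laws,
  associativity and inverses all come from choices of \<rho>.\<close>

lemma loop_reparametrise:
  assumes f: "f \<in> loops m X x" and i: "i < m"
    and cont: "continuous_map (prod_topology unit_interval unit_interval) euclideanreal \<rho>"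
    and range: "\<And>t a. 0 \<le> t \<Longrightarrow> t \<le> 1 \<Longrightarrow> 0 \<le> a \<Longrightarrow> a \<le> 1 \<Longrightarrow> 0 \<le> \<rho> (t, a) \<and> \<rho> (t, a) \<le> 1"
    and ends: "\<And>t a. 0 \<le> t \<Longrightarrow> t \<le> 1 \<Longrightarrow> a = 0 \<or> a = 1 \<Longrightarrow> \<rho> (t, a) = 0 \<or> \<rho> (t, a) = 1"
  shows "loop_homotopic m X x (\<lambda>s. f (s(i := \<rho> (0, s i)))) (\<lambda>s. f (s(i := \<rho> (1, s i))))"
proof (rule loop_homotopicI[where h="\<lambda>(t, s). f (s(i := \<rho> (t, s i)))"])
  let ?Z = "prod_topology unit_interval (unit_cube m)"
  have "continuous_map ?Z unit_interval (\<lambda>z. snd z i)"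
    using continuous_map_snd[of unit_interval "unit_cube m"] i
    by (simp only: continuous_map_unit_cube)
  then have "continuous_map ?Z euclideanreal (\<lambda>z. \<rho> (fst z, snd z i))"
    by (intro continuous_map_pair_arg[OF cont] continuous_map_fst)
  then have "continuous_map ?Z (unit_cube m) (\<lambda>z. (snd z)(i := \<rho> (fst z, snd z i)))"
    using range unit_cube_nth i by (intro continuous_map_cube_upd continuous_map_snd) auto
  from continuous_map_compose[OF this loops_continuous[OF f]]
  show "continuous_map ?Z X (\<lambda>(t, s). f (s(i := \<rho> (t, s i))))"
    by (simp add: o_def case_prod_unfold)
next
  fix t :: real and s
  assume t: "0 \<le> t" "t \<le> 1" and s: "s \<in> cube_boundary m"
  then have "s(i := \<rho> (t, s i)) \<in> cube_boundary m"
    using cube_boundary_subset[of m] i range ends unit_cube_nth by (intro cube_boundary_upd) blast+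
  then show "(case (t, s) of (t, s) \<Rightarrow> f (s(i := \<rho> (t, s i)))) = x"
    using loops_boundary[OF f] by simp
qed simp_all

lemma loop_reparametrise_id:
  assumes f: "f \<in> loops m X x" and i: "i < m"
    and cont: "continuous_map unit_interval euclideanreal \<rho>"
    and range: "\<And>a. 0 \<le> a \<Longrightarrow> a \<le> 1 \<Longrightarrow> 0 \<le> \<rho> a \<and> \<rho> a \<le> 1"
    and ends: "\<rho> 0 = 0" "\<rho> 1 = 1"
  shows "loop_homotopic m X x f (\<lambda>s. f (s(i := \<rho> (s i))))"
proof -
  \<comment> \<open>The straight line from the identity to \<rho>; it stays in the interval by
    convexity and fixes both ends.\<close>
  let ?\<rho> = "\<lambda>(t, a). (1 - t) * a + t * \<rho> a"
  have "loop_homotopic m X x (\<lambda>s. f (s(i := ?\<rho> (0, s i)))) (\<lambda>s. f (s(i := ?\<rho> (1, s i))))"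
  proof (rule loop_reparametrise[OF f i])
    have "continuous_map (prod_topology unit_interval unit_interval) euclideanreal (\<lambda>z. \<rho> (snd z))"
      using continuous_map_compose[OF continuous_map_snd cont] unfolding o_def .
    moreover have "continuous_map (prod_topology unit_interval unit_interval) euclideanreal fst"
      "continuous_map (prod_topology unit_interval unit_interval) euclideanreal snd"
      by (metis continuous_map_fst continuous_map_into_fulltopology,
          metis continuous_map_snd continuous_map_into_fulltopology)
    ultimately show "continuous_map (prod_topology unit_interval unit_interval) euclideanreal ?\<rho>"
      unfolding case_prod_unfold by (intro continuous_intros) auto
  next
    fix t a :: real
    assume "0 \<le> t" "t \<le> 1" "0 \<le> a" "a \<le> 1"
    then show "0 \<le> ?\<rho> (t, a) \<and> ?\<rho> (t, a) \<le> 1"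
      using range[of a] convex_bound_le[of a 1 "\<rho> a" "1 - t" t] by simp
  next
    fix t a :: real
    assume "a = 0 \<or> a = 1"
    then show "?\<rho> (t, a) = 0 \<or> ?\<rho> (t, a) = 1"
      using ends by auto
  qed
  then show ?thesis by simp
qed

section \<open>The homotopy groups\<close>

definition add_along ::
  "nat \<Rightarrow> ((nat \<Rightarrow> real) \<Rightarrow> 'a) \<Rightarrow> ((nat \<Rightarrow> real) \<Rightarrow> 'a) \<Rightarrow> (nat \<Rightarrow> real) \<Rightarrow> 'a"
  where "add_along i f g =
    (\<lambda>s. if s i \<le> 1/2 then f (s(i := 2 * s i)) else g (s(i := 2 * s i - 1)))"

definition reverse_along :: "nat \<Rightarrow> ((nat \<Rightarrow> real) \<Rightarrow> 'a) \<Rightarrow> (nat \<Rightarrow> real) \<Rightarrow> 'a"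
  where "reverse_along i f = (\<lambda>s. f (s(i := 1 - s i)))"

lemma loop_add_eq: "loop_add = add_along 0"
  by (simp add: loop_add_def add_along_def fun_eq_iff)

lemma compose_add_along: "h \<circ> add_along i f g = add_along i (h \<circ> f) (h \<circ> g)"
  by (auto simp: add_along_def)

lemma add_along_interchange:
  assumes "i \<noteq> k"
  shows "add_along i (add_along k a b) (add_along k c d) = add_along k (add_along i a c) (add_along i b d)"
  using assms by (auto simp: add_along_def fun_upd_twist)

lemma add_along_homotopic:
  assumes f: "loop_homotopic m X x f f'" and g: "loop_homotopic m X x g g'" and i: "i < m"
  shows "loop_homotopic m X x (add_along i f g) (add_along i f' g')"
proof -
  let ?Z = "prod_topology unit_interval (unit_cube m)"
  from f obtain H where H: "continuous_map ?Z X H"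
    "\<And>s. s \<in> topspace (unit_cube m) \<Longrightarrow> H (0, s) = f s"
    "\<And>s. s \<in> topspace (unit_cube m) \<Longrightarrow> H (1, s) = f' s"
    "\<And>t s. 0 \<le> t \<Longrightarrow> t \<le> 1 \<Longrightarrow> s \<in> cube_boundary m \<Longrightarrow> H (t, s) = x"
    by (rule loop_homotopicE) blast
  from g obtain K where K: "continuous_map ?Z X K"
    "\<And>s. s \<in> topspace (unit_cube m) \<Longrightarrow> K (0, s) = g s"
    "\<And>s. s \<in> topspace (unit_cube m) \<Longrightarrow> K (1, s) = g' s"
    "\<And>t s. 0 \<le> t \<Longrightarrow> t \<le> 1 \<Longrightarrow> s \<in> cube_boundary m \<Longrightarrow> K (t, s) = x"
    by (rule loop_homotopicE) blast
  \<comment> \<open>The clamps by \<open>min\<close> and \<open>max\<close> keep the argument in the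
    cube everywhere, so each piece is continuous on the whole product; on its own half a clamp
    changes nothing. Where the coordinate is 1/2, the pieces lie on the faces 1 and 0 and both give
    \<open>x\<close>.\<close>
  let ?l = "\<lambda>z. (fst z, (snd z)(i := min 1 (2 * snd z i)))"
  let ?r = "\<lambda>z. (fst z, (snd z)(i := max 0 (2 * snd z i - 1)))"
  let ?h = "\<lambda>z. if snd z i \<le> 1/2 then H (?l z) else K (?r z)"
  have coord: "continuous_map ?Z euclideanreal (\<lambda>z. snd z i)"
    by (rule continuous_map_unit_cube_nth[OF continuous_map_snd i])

  have "continuous_map ?Z ?Z ?l" "continuous_map ?Z ?Z ?r"
    using i unit_cube_nth
    by (auto intro!: continuous_map_pairedI continuous_map_fst continuous_map_snd
        continuous_map_cube_upd continuous_intros coord)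
  then have "continuous_map ?Z X (H \<circ> ?l)" "continuous_map ?Z X (K \<circ> ?r)"
    using H(1) K(1) continuous_map_compose by blast+
  then have "continuous_map ?Z X ?h"
    using coord
    by (intro continuous_map_cases_le)
      (auto simp: o_def H(4) K(4) i cube_boundary_face intro!: continuous_map_from_subtopology)
  then show ?thesis
  proof (rule loop_homotopicI)
    fix t :: real and s
    assume t: "0 \<le> t" "t \<le> 1" and s: "s \<in> cube_boundary m"
    then have "0 \<le> s i \<and> s i \<le> 1"
      using cube_boundary_subset[of m] i unit_cube_nth by blast
    then have "s(i := min 1 (2 * s i)) \<in> cube_boundary m" "s(i := max 0 (2 * s i - 1)) \<in> cube_boundary m"
      using s i by (auto intro!: cube_boundary_upd)
    with t have "H (?l (t, s)) = x" "K (?r (t, s)) = x"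
      using H(4) K(4) unfolding fst_conv snd_conv by blast+
    then show "?h (t, s) = x"
      by presburger
  next
    fix s assume s: "s \<in> topspace (unit_cube m)"
    have *: "?h (t, s) = add_along i (\<lambda>s. H (t, s)) (\<lambda>s. K (t, s)) s" for t
      by (simp add: add_along_def min_absorb2 max_absorb2)
    have "s(i := 2 * s i) \<in> topspace (unit_cube m)" if "s i \<le> 1/2"
      using unit_cube_nth[OF s i] s i that by (intro unit_cube_upd) auto
    moreover have "s(i := 2 * s i - 1) \<in> topspace (unit_cube m)" if "\<not> s i \<le> 1/2"
      using unit_cube_nth[OF s i] s i that by (intro unit_cube_upd) auto
    ultimately show "?h (0, s) = add_along i f g s" "?h (1, s) = add_along i f' g' s"
      unfolding * by (simp_all add: add_along_def H K)
  qed
qed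

lemma add_along_loops:
  "f \<in> loops m X x \<Longrightarrow> g \<in> loops m X x \<Longrightarrow> i < m \<Longrightarrow> add_along i f g \<in> loops m X x"
  using add_along_homotopic loop_homotopic_refl by metis

lemma add_along_const:
  assumes f: "f \<in> loops m X x" and i: "i < m"
  shows "loop_homotopic m X x (add_along i f (\<lambda>s. x)) f" "loop_homotopic m X x (add_along i (\<lambda>s. x) f) f"
proof -
  \<comment> \<open>Running through \<open>f\<close> at double speed leaves the second half on the
    face with coordinate 1, where \<open>f\<close> is \<open>x\<close>.\<close>
  have "loop_homotopic m X x f (\<lambda>s. f (s(i := min 1 (2 * s i))))"
    by (rule loop_reparametrise_id[OF f i]) (auto intro!: continuous_intros)
  also have "loop_homotopic m X x \<dots> (add_along i f (\<lambda>s. x))"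
    by (rule loop_homotopic_equal[OF loop_homotopic_imp_loops(2)[OF calculation]])
      (auto simp: add_along_def min_def i cube_boundary_face loops_boundary[OF f])
  finally show "loop_homotopic m X x (add_along i f (\<lambda>s. x)) f"
    by (rule loop_homotopic_sym)
  have "loop_homotopic m X x f (\<lambda>s. f (s(i := max 0 (2 * s i - 1))))"
    by (rule loop_reparametrise_id[OF f i]) (auto intro!: continuous_intros)
  also have "loop_homotopic m X x \<dots> (add_along i (\<lambda>s. x) f)"
    by (rule loop_homotopic_equal[OF loop_homotopic_imp_loops(2)[OF calculation]])
      (auto simp: add_along_def max_def i cube_boundary_face loops_boundary[OF f])
  finally show "loop_homotopic m X x (add_along i (\<lambda>s. x) f) f"
    by (rule loop_homotopic_sym)
qed

lemma add_along_assoc: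
  assumes f: "f \<in> loops m X x" and g: "g \<in> loops m X x" and h: "h \<in> loops m X x" and i: "i < m"
  shows "loop_homotopic m X x (add_along i (add_along i f g) h) (add_along i f (add_along i g h))"
proof -
  \<comment> \<open>The piecewise linear map that carries the breaks 1/4 and 1/2 of the left
    bracketing to the breaks 1/2 and 3/4 of the right one. Its slopes 2, 1, 1/2 decrease, so it is
    the minimum of its three linear pieces.\<close>
  let ?\<rho> = "\<lambda>a::real. min (2 * a) (min (a + 1/4) (a / 2 + 1/2))"
  let ?F = "add_along i f (add_along i g h)"
  have "?F \<in> loops m X x"
    by (intro add_along_loops f g h i)
  then have "loop_homotopic m X x ?F (\<lambda>s. ?F (s(i := ?\<rho> (s i))))"
    using i by (rule loop_reparametrise_id) (auto intro!: continuous_intros)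
  also have "(\<lambda>s. ?F (s(i := ?\<rho> (s i)))) = add_along i (add_along i f g) h"
  proof
    fix s :: "nat \<Rightarrow> real"
    consider "s i \<le> 1/4" | "1/4 < s i" "s i \<le> 1/2" | "1/2 < s i" by linarith
    then show "?F (s(i := ?\<rho> (s i))) = add_along i (add_along i f g) h s"
    proof cases
      case 1
      then have "?\<rho> (s i) = 2 * s i" by simp
      with 1 show ?thesis by (simp add: add_along_def)
    next
      case 2
      then have "?\<rho> (s i) = s i + 1/4" by simp
      with 2 show ?thesis by (simp add: add_along_def algebra_simps)
    next
      case 3
      then have "?\<rho> (s i) = s i / 2 + 1/2" by simp
      with 3 show ?thesis by (simp add: add_along_def algebra_simps)
    qed
  qed
  finally show ?thesis by (rule loop_homotopic_sym)
qed

lemma reverse_along_loops: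
  assumes f: "f \<in> loops m X x" and i: "i < m"
  shows "reverse_along i f \<in> loops m X x"
proof -
  have "loop_homotopic m X x (\<lambda>s. f (s(i := (\<lambda>z. 1 - snd z) (0::real, s i))))
      (\<lambda>s. f (s(i := (\<lambda>z. 1 - snd z) (1::real, s i))))"
    using f i by (rule loop_reparametrise) (auto intro!: continuous_intros)
  then show ?thesis by (simp add: loop_homotopic_refl reverse_along_def)
qed

lemma add_along_reverse:
  assumes f: "f \<in> loops m X x" and i: "i < m"
  shows "loop_homotopic m X x (add_along i (reverse_along i f) f) (\<lambda>s. x)"
proof -
  \<comment> \<open>At time 0 this runs from 1 down to 0 and back. The rising floor
    \<open>fst z\<close> cuts the excursion off until, at time 1, everything stays on the face where
    \<open>f\<close> is \<open>x\<close>.\<close>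
  let ?\<rho> = "\<lambda>z::real \<times> real. max (fst z) \<bar>2 * snd z - 1\<bar>"
  have *: "loop_homotopic m X x (\<lambda>s. f (s(i := ?\<rho> (0, s i)))) (\<lambda>s. f (s(i := ?\<rho> (1, s i))))"
    using f i by (rule loop_reparametrise) (auto intro!: continuous_intros)
  have "add_along i (reverse_along i f) f s = f (s(i := ?\<rho> (0, s i)))" for s
  proof (cases "s i \<le> 1/2")
    case True
    then have "?\<rho> (0, s i) = 1 - 2 * s i" by simp
    with True show ?thesis by (simp add: add_along_def reverse_along_def)
  next
    case False
    then have "?\<rho> (0, s i) = 2 * s i - 1" by simp
    with False show ?thesis by (simp add: add_along_def)
  qed
  then have "loop_homotopic m X x (add_along i (reverse_along i f) f) (\<lambda>s. f (s(i := ?\<rho> (1, s i))))"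
    using * by presburger
  also have "loop_homotopic m X x (\<lambda>s. f (s(i := ?\<rho> (1, s i)))) (\<lambda>s. x)"
  proof (rule loop_homotopic_equal[OF loop_homotopic_imp_loops(2)[OF *]])
    fix s assume s: "s \<in> topspace (unit_cube m)"
    then have "?\<rho> (1, s i) = 1" using unit_cube_nth[OF s i] by auto
    then show "f (s(i := ?\<rho> (1, s i))) = x"
      using cube_boundary_face[OF s i, of 1] loops_boundary[OF f] by simp
  qed
  finally show ?thesis .
qed

text \<open>The Eckmann-Hilton argument: both sides agree with a sum of four loops, two of them constant.\<close>

lemma add_along_direction:
  assumes f: "f \<in> loops m X x" and g: "g \<in> loops m X x" and "i < m" "k < m"
  shows "loop_homotopic m X x (add_along i f g) (add_along k f g)"
proof (cases "i = k")
  case True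
  then show ?thesis using assms add_along_loops loop_homotopic_refl by metis
next
  case False
  let ?c = "\<lambda>s. x"
  have "loop_homotopic m X x (add_along i f g) (add_along i (add_along k f ?c) (add_along k ?c g))"
    using assms by (intro add_along_homotopic loop_homotopic_sym[OF add_along_const(1)]
        loop_homotopic_sym[OF add_along_const(2)])
  also have "add_along i (add_along k f ?c) (add_along k ?c g) = add_along k (add_along i f ?c) (add_along i ?c g)"
    by (rule add_along_interchange[OF False])
  also have "loop_homotopic m X x \<dots> (add_along k f g)"
    using assms by (intro add_along_homotopic add_along_const)
  finally show ?thesis .
qed

lemma carrier_homotopy_group: "carrier (homotopy_group m X x) = loop_class m X x ` loops m X x"
  by (simp add: homotopy_group_def)

lemma one_homotopy_group: "\<one>\<^bsub>homotopy_group m X x\<^esub> = loop_class m X x (\<lambda>s. x)"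
  by (simp add: homotopy_group_def)

text \<open>Compatibility with homotopy makes all the classes in the union equal, and
  \<open>f\<close> itself makes the union nonempty.\<close>

lemma Union_loop_class:
  assumes f: "f \<in> loops m X x"
    and F: "\<And>f'. loop_homotopic m X x f f' \<Longrightarrow> loop_homotopic k Y y (F f) (F f')"
  shows "(\<Union>f'\<in>loop_class m X x f. loop_class k Y y (F f')) = loop_class k Y y (F f)"
proof -
  have "loop_class k Y y (F f') = loop_class k Y y (F f)" if "f' \<in> loop_class m X x f" for f'
    using F[of f'] that loop_class_eq_iff loop_homotopic_imp_loops(1) mem_loop_class by metis
  moreover have "f \<in> loop_class m X x f"
    using f by (simp add: mem_loop_class loop_homotopic_refl)
  ultimately show ?thesis by blast
qed

lemma Union_loop_class2:
  assumes f: "f \<in> loops m X x" and g: "g \<in> loops n X x"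
    and F: "\<And>f' g'. loop_homotopic m X x f f' \<Longrightarrow> loop_homotopic n X x g g' \<Longrightarrow>
      loop_homotopic k Y y (F f g) (F f' g')"
  shows "(\<Union>f'\<in>loop_class m X x f. \<Union>g'\<in>loop_class n X x g. loop_class k Y y (F f' g')) =
    loop_class k Y y (F f g)"
proof -
  have "loop_class k Y y (F f' g') = loop_class k Y y (F f g)"
    if "f' \<in> loop_class m X x f" "g' \<in> loop_class n X x g" for f' g'
    using F[of f' g'] that loop_class_eq_iff loop_homotopic_imp_loops(1) mem_loop_class by metis
  moreover have "f \<in> loop_class m X x f" "g \<in> loop_class n X x g"
    using f g by (simp_all add: mem_loop_class loop_homotopic_refl)
  ultimately show ?thesis by blast
qed

text \<open>The free index \<open>i\<close> is the point: by the Eckmann-Hilton argument the product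
  may be computed in any direction, in particular across the slabs of an infinite sum.\<close>

lemma mult_homotopy_group:
  assumes "f \<in> loops m X x" "g \<in> loops m X x" "i < m"
  shows "loop_class m X x f \<otimes>\<^bsub>homotopy_group m X x\<^esub> loop_class m X x g = loop_class m X x (add_along i f g)"
proof -
  have "loop_class m X x f \<otimes>\<^bsub>homotopy_group m X x\<^esub> loop_class m X x g = loop_class m X x (add_along 0 f g)"
    using assms unfolding homotopy_group_def loop_add_eq monoid.simps
    by (intro Union_loop_class2 add_along_homotopic) auto
  also have "\<dots> = loop_class m X x (add_along i f g)"
    using assms by (simp add: loop_class_eq_iff add_along_loops add_along_direction)
  finally show ?thesis .
qed

lemma group_homotopy_group:
  assumes x: "x \<in> topspace X" and m: "m > 0"
  shows "group (homotopy_group m X x)"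
proof (rule groupI)
  let ?G = "homotopy_group m X x"
  note [simp] = carrier_homotopy_group one_homotopy_group mult_homotopy_group[OF _ _ m]
    add_along_loops[OF _ _ m] loop_class_eq_iff loops_const[OF x] imageI
  show "\<one>\<^bsub>?G\<^esub> \<in> carrier ?G" by simp
  show "a \<otimes>\<^bsub>?G\<^esub> b \<in> carrier ?G" if "a \<in> carrier ?G" "b \<in> carrier ?G" for a b
    using that by auto
  show "a \<otimes>\<^bsub>?G\<^esub> b \<otimes>\<^bsub>?G\<^esub> c = a \<otimes>\<^bsub>?G\<^esub> (b \<otimes>\<^bsub>?G\<^esub> c)"
    if "a \<in> carrier ?G" "b \<in> carrier ?G" "c \<in> carrier ?G" for a b c
  proof -
    from that obtain f g h where "f \<in> loops m X x" "g \<in> loops m X x" "h \<in> loops m X x"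
      and "a = loop_class m X x f" "b = loop_class m X x g" "c = loop_class m X x h"
      by auto
    with m show ?thesis by (simp add: add_along_assoc)
  qed
  show "\<one>\<^bsub>?G\<^esub> \<otimes>\<^bsub>?G\<^esub> a = a" if "a \<in> carrier ?G" for a
  proof -
    from that obtain f where "f \<in> loops m X x" "a = loop_class m X x f" by auto
    with m show ?thesis by (simp add: add_along_const)
  qed
  show "\<exists>b\<in>carrier ?G. b \<otimes>\<^bsub>?G\<^esub> a = \<one>\<^bsub>?G\<^esub>" if "a \<in> carrier ?G" for a
  proof -
    from that obtain f where f: "f \<in> loops m X x" "a = loop_class m X x f" by auto
    then have "loop_class m X x (reverse_along 0 f) \<otimes>\<^bsub>?G\<^esub> a = \<one>\<^bsub>?G\<^esub>"
      using m by (simp add: reverse_along_loops add_along_reverse)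
    with f m show ?thesis by (auto intro!: bexI simp: reverse_along_loops)
  qed
qed

lemma inv_homotopy_group:
  assumes x: "x \<in> topspace X" and f: "f \<in> loops m X x" and i: "i < m"
  shows "inv\<^bsub>homotopy_group m X x\<^esub> (loop_class m X x f) = loop_class m X x (reverse_along i f)"
proof (rule group.inv_equality)
  show "group (homotopy_group m X x)"
    using x i by (intro group_homotopy_group) auto
qed (use assms in \<open>auto simp: mult_homotopy_group[OF _ _ i] carrier_homotopy_group one_homotopy_group
      reverse_along_loops add_along_loops loop_class_eq_iff add_along_reverse\<close>)

lemma induced_map_loop_class:
  assumes "f \<in> loops m X x" "continuous_map X Y h"
  shows "induced_map m Y (h x) h (loop_class m X x f) = loop_class m Y (h x) (h \<circ> f)"
  unfolding induced_map_def using assms by (intro Union_loop_class loop_homotopic_compose)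

lemma group_hom_induced_map:
  assumes x: "x \<in> topspace X" and h: "continuous_map X Y h" and m: "m > 0"
  shows "group_hom (homotopy_group m X x) (homotopy_group m Y (h x)) (induced_map m Y (h x) h)"
proof -
  have "h x \<in> topspace Y"
    using x h continuous_map_image_subset_topspace by fast
  moreover have "induced_map m Y (h x) h \<in> hom (homotopy_group m X x) (homotopy_group m Y (h x))"
    using loops_compose[OF _ h]
    by (auto simp: hom_def carrier_homotopy_group induced_map_loop_class[OF _ h]
        mult_homotopy_group[OF _ _ m] add_along_loops[OF _ _ m] compose_add_along)
  ultimately show ?thesis
    using x m by (simp add: group_hom_def group_hom_axioms_def group_homotopy_group)
qed

section \<open>Infinite sums\<close>

lemma slab_width:
  "(real j + 1) / (real j + 2) - real j / (real j + 1) = 1 / ((real j + 1) * (real j + 2))"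
  by (simp add: field_simps)

lemma slab_le:
  assumes "i \<le> j" shows "real i / (real i + 1) \<le> real j / (real j + 1)"
  using assms by (simp add: field_simps)

lemma infinite_sum_one: "s 0 = 1 \<Longrightarrow> infinite_sum x f s = x"
  by (simp add: infinite_sum_def)

text \<open>\<open>LEAST\<close> assigns a common wall to the slab below it, so the lower bound is
  strict except for the slab with index 0.\<close>

lemma infinite_sum_slab:
  assumes lower: "j = 0 \<or> real j / (real j + 1) < s 0" and upper: "s 0 \<le> (real j + 1) / (real j + 2)"
  shows "infinite_sum x f s = f j (s(0 := (s 0 - real j / (real j + 1)) * ((real j + 1) * (real j + 2))))"
proof -
  have "(LEAST j. s 0 \<le> real (j + 1) / real (j + 2)) = j"
  proof (rule Least_equality)
    show "s 0 \<le> real (j + 1) / real (j + 2)"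
      using upper by (simp add: add.commute)
    show "j \<le> i" if "s 0 \<le> real (i + 1) / real (i + 2)" for i
    proof (rule ccontr)
      assume "\<not> j \<le> i"
      then have "s 0 \<le> real j / (real j + 1)"
        using that slab_le[of "i + 1" j] by (simp add: add.commute)
      with lower \<open>\<not> j \<le> i\<close> show False by auto
    qed
  qed
  moreover have "s 0 \<noteq> 1"
    using upper by auto
  ultimately show ?thesis
    by (simp add: infinite_sum_def Let_def add.commute)
qed

lemma slab_coordinate:
  assumes "j = 0 \<and> 0 \<le> a \<or> real j / (real j + 1) < a" "a \<le> (real j + 1) / (real j + 2)"
  shows "0 \<le> (a - real j / (real j + 1)) * ((real j + 1) * (real j + 2))"
    and "(a - real j / (real j + 1)) * ((real j + 1) * (real j + 2)) \<le> 1"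
proof -
  show "0 \<le> (a - real j / (real j + 1)) * ((real j + 1) * (real j + 2))"
    using assms by (intro mult_nonneg_nonneg) auto
  have "a - real j / (real j + 1) \<le> 1 / ((real j + 1) * (real j + 2))"
    using assms(2) slab_width[of j] by linarith
  then show "(a - real j / (real j + 1)) * ((real j + 1) * (real j + 2)) \<le> 1"
    by (subst (asm) pos_le_divide_eq) (auto intro: mult_pos_pos)
qed

lemma slab_exists:
  assumes "0 \<le> a" "a < (1::real)"
  obtains j where "j = 0 \<and> 0 \<le> a \<or> real j / (real j + 1) < a" "a \<le> (real j + 1) / (real j + 2)"
proof -
  let ?P = "\<lambda>j. a \<le> (real j + 1) / (real j + 2)"
  \<comment> \<open>Since \<open>(n+1)/(n+2)\<close> equals \<open>1 - 1/(n+2)\<close>, every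
    \<open>n\<close> above \<open>1/(1-a)\<close> satisfies \<open>?P\<close>. If the least such
    index is positive, its predecessor fails \<open>?P\<close>, which is the strict lower
    bound.\<close>
  obtain n where n: "1 / (1 - a) < real n"
    using reals_Archimedean2 by blast
  have "1 < real n * (1 - a)"
    using n assms by (simp add: pos_divide_less_eq)
  then have "?P n"
    using assms by (simp add: field_simps)
  then have *: "?P (LEAST j. ?P j)"
    by (rule LeastI)
  show ?thesis
  proof (cases "LEAST j. ?P j")
    case 0
    then show ?thesis using that[of 0] * assms by auto
  next
    case (Suc k)
    then have "\<not> ?P k" using not_less_Least[of k ?P] by simp
    then have "real (Suc k) / (real (Suc k) + 1) < a" by (simp add: add.commute)
    then show ?thesis using that[of "Suc k"] * Suc by simp
  qed
qed

text \<open>The index \<open>j\<close> and the new coordinate \<open>c\<close> depend on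
  \<open>s\<close> alone, so one choice serves to compare several sums at the same point. The clause
  on \<open>s 0 = 0\<close> keeps points of that face on the boundary.\<close>

lemma infinite_sum_term:
  fixes s :: "nat \<Rightarrow> real"
  assumes "0 \<le> s 0" "s 0 < 1"
  obtains j c where "0 \<le> c" "c \<le> 1" "s 0 = 0 \<Longrightarrow> c = 0"
    and "\<And>x (f :: nat \<Rightarrow> (nat \<Rightarrow> real) \<Rightarrow> 'a). infinite_sum x f s = f j (s(0 := c))"
proof -
  obtain j where j: "j = 0 \<and> 0 \<le> s 0 \<or> real j / (real j + 1) < s 0" "s 0 \<le> (real j + 1) / (real j + 2)"
    using assms by (rule slab_exists)
  let ?c = "(s 0 - real j / (real j + 1)) * ((real j + 1) * (real j + 2))"
  have "j = 0" if "s 0 = 0"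
    using j(1) that by (auto simp: divide_less_0_iff)
  then have "s 0 = 0 \<Longrightarrow> ?c = 0" by simp
  moreover have "infinite_sum x f s = f j (s(0 := ?c))" for x :: 'a and f
    by (rule infinite_sum_slab) (use j in auto)
  ultimately show ?thesis
    using slab_coordinate[OF j] that by blast
qed

text \<open>Smallness is asked of the whole homotopies and not only of their ends: the slabs
  accumulate at the face \<open>s 0 = 1\<close>, and continuity there requires late terms to lie in
  a given neighbourhood at all times.\<close>

lemma infinite_sum_homotopic:
  fixes H :: "nat \<Rightarrow> real \<times> (nat \<Rightarrow> real) \<Rightarrow> 'a"
  defines "Z m \<equiv> prod_topology unit_interval (unit_cube m)"
  assumes x: "x \<in> topspace X" and m: "m > 0"
    and H: "\<And>j. continuous_map (Z m) X (H j)"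
    and bd: "\<And>j t s. 0 \<le> t \<Longrightarrow> t \<le> 1 \<Longrightarrow> s \<in> cube_boundary m \<Longrightarrow> H j (t, s) = x"
    and null: "\<And>U. openin X U \<Longrightarrow> x \<in> U \<Longrightarrow> \<forall>\<^sub>\<infinity>j. H j ` topspace (Z m) \<subseteq> U"
  shows "loop_homotopic m X x (infinite_sum x (\<lambda>j s. H j (0, s))) (infinite_sum x (\<lambda>j s. H j (1, s)))"
proof -
  define S where "S = (\<lambda>z. infinite_sum x (\<lambda>j s. H j (fst z, s)) (snd z))"
  define c :: "nat \<Rightarrow> real \<Rightarrow> real"
    where "c j a = (a - real j / (real j + 1)) * ((real j + 1) * (real j + 2))" for j a
  \<comment> \<open>\<open>G N\<close> is the sum of the first \<open>N\<close> terms, continued by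
    \<open>x\<close> beyond \<open>N / (N + 1)\<close>. The recursion reduces its continuity to
    gluing one slab at a time; the clamps again keep arguments in the cube.\<close>
  define G where "G = rec_nat (\<lambda>z. x) (\<lambda>j Gj z. if snd z 0 \<le> real j / (real j + 1) then Gj z
    else H j (fst z, (snd z)(0 := max 0 (min 1 (c j (snd z 0))))))"
  have G0: "G 0 = (\<lambda>z. x)"
    and G_Suc: "G (Suc j) = (\<lambda>z. if snd z 0 \<le> real j / (real j + 1) then G j z
      else H j (fst z, (snd z)(0 := max 0 (min 1 (c j (snd z 0))))))" for j
    unfolding G_def by simp_all
  have coord: "continuous_map (Z m) euclideanreal (\<lambda>z. snd z 0)"
    unfolding Z_def by (rule continuous_map_unit_cube_nth[OF continuous_map_snd m])
  have Zs: "0 \<le> fst z" "fst z \<le> 1" "snd z \<in> topspace (unit_cube m)" "0 \<le> snd z 0" "snd z 0 \<le> 1"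
    if "z \<in> topspace (Z m)" for z
    using that unit_cube_nth[of "snd z" m 0] m by (auto simp: Z_def)
  have face: "H j (fst z, (snd z)(0 := a)) = x" if "z \<in> topspace (Z m)" "a = 0 \<or> a = 1" for j z a
    using Zs[OF that(1)] that(2) m by (intro bd cube_boundary_face) auto
  have c_lower: "c j (real j / (real j + 1)) = 0" for j
    by (simp add: c_def)
  have c_upper: "1 \<le> c j a" if "(real j + 1) / (real j + 2) \<le> a" for j a
  proof -
    have "1 / ((real j + 1) * (real j + 2)) \<le> a - real j / (real j + 1)"
      using that slab_width[of j] by linarith
    then show ?thesis
      unfolding c_def by (subst (asm) pos_divide_le_eq) (auto intro: mult_pos_pos)
  qed
  have G_beyond: "G N z = x" if "z \<in> topspace (Z m)" "real N / (real N + 1) \<le> snd z 0" for N z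
  proof (cases N)
    case (Suc j)
    then have "(real j + 1) / (real j + 2) \<le> snd z 0"
      using that by (simp add: add.commute)
    then have "1 \<le> c j (snd z 0)" and "real j / (real j + 1) < snd z 0"
      using c_upper slab_width[of j]
      by (simp, smt (verit) divide_pos_pos of_nat_0_le_iff mult_pos_pos)
    then show ?thesis
      using face[OF that(1)] by (simp add: Suc G_Suc)
  qed (simp add: G0)
  have G_cont: "continuous_map (Z m) X (G N)" for N
  proof (induction N)
    case 0
    then show ?case using x by (simp add: G0)
  next
    case (Suc j)
    let ?r = "\<lambda>z. (fst z, (snd z)(0 := max 0 (min 1 (c j (snd z 0)))))"
    have "continuous_map (Z m) (Z m) ?r"
      using coord m unfolding c_def Z_def
      by (intro continuous_map_pairedI continuous_map_fst continuous_map_snd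
          continuous_map_cube_upd continuous_intros) auto
    then have "continuous_map (Z m) X (\<lambda>z. H j (?r z))"
      using continuous_map_compose[OF _ H] by (simp add: o_def)
    then show ?case
      unfolding G_Suc
    proof (intro continuous_map_cases_le coord continuous_map_from_subtopology Suc)
      fix z assume z: "z \<in> topspace (Z m)" "snd z 0 = real j / (real j + 1)"
      then have "G j z = x" by (intro G_beyond) auto
      then show "G j z = H j (?r z)"
        using face[OF z(1)] unfolding z(2) c_lower by simp
    qed auto
  qed
  have G_eq: "G N z = S z" if "z \<in> topspace (Z m)" "snd z 0 \<le> real N / (real N + 1)" for N z
    using that
  proof (induction N)
    case 0
    then have "snd z 0 = 0" using Zs(4)[of z] by simp
    \<comment> \<open>On the face \<open>s 0 = 0\<close> the sum evaluates term 0 on its lower face,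
      which agrees with the constant \<open>G 0\<close>.\<close>
    moreover have "H 0 (fst z, (snd z)(0 := 0)) = x"
      using 0 by (intro face) auto
    ultimately show ?case
      by (simp add: S_def G0 infinite_sum_slab[of 0 "snd z"])
  next
    case (Suc j)
    show ?case
    proof (cases "snd z 0 \<le> real j / (real j + 1)")
      case True
      then show ?thesis using Suc by (simp add: G_Suc)
    next
      case False
      then have *: "real j / (real j + 1) < snd z 0" "snd z 0 \<le> (real j + 1) / (real j + 2)"
        using Suc.prems by (simp_all add: add.commute)
      then have "0 \<le> c j (snd z 0)" "c j (snd z 0) \<le> 1"
        unfolding c_def using slab_coordinate by blast+
      then show ?thesis
        using * infinite_sum_slab[of j "snd z" x "\<lambda>j s. H j (fst z, s)"] by (simp add: G_Suc S_def c_def)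
    qed
  qed
  \<comment> \<open>Away from the last face, \<open>S\<close> coincides near every point with some
    \<open>G N\<close>. Smallness of the terms enters only at the last face.\<close>
  have "continuous_map (Z m) X S"
    unfolding continuous_map_def
  proof (intro conjI allI impI)
    have S_end: "S z = x" if "snd z 0 = 1" for z
      using that by (simp add: S_def infinite_sum_one)
    have S_inner: "\<exists>N. snd z 0 < real N / (real N + 1)" if z: "z \<in> topspace (Z m)" and "snd z 0 \<noteq> 1" for z
    proof -
      have "snd z 0 < 1" using Zs[OF z] that(2) by simp
      with Zs(4)[OF z] obtain j where "snd z 0 \<le> (real j + 1) / (real j + 2)"
        by (rule slab_exists)
      also have "\<dots> < real (j + 2) / (real (j + 2) + 1)"
        by (simp add: field_simps)
      finally show ?thesis by blast
    qed
    show "S \<in> topspace (Z m) \<rightarrow> topspace X"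
    proof
      fix z assume z: "z \<in> topspace (Z m)"
      show "S z \<in> topspace X"
      proof (cases "snd z 0 = 1")
        case False
        then obtain N where "snd z 0 < real N / (real N + 1)" using S_inner z by blast
        then have "S z = G N z" using G_eq[OF z, of N] by simp
        then show ?thesis using z G_cont[of N] continuous_map_image_subset_topspace by fastforce
      qed (use x S_end in simp)
    qed
    fix U assume U: "openin X U"
    show "openin (Z m) {z \<in> topspace (Z m). S z \<in> U}"
    proof (subst openin_subopen, safe)
      fix z assume z: "z \<in> topspace (Z m)" "S z \<in> U"
      show "\<exists>T. openin (Z m) T \<and> z \<in> T \<and> T \<subseteq> {z \<in> topspace (Z m). S z \<in> U}"
      proof (cases "snd z 0 = 1")
        case False
        then obtain N where N: "snd z 0 < real N / (real N + 1)" using S_inner z by blast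
        let ?T = "{z \<in> topspace (Z m). snd z 0 \<in> {..<real N / (real N + 1)}} \<inter> {z \<in> topspace (Z m). G N z \<in> U}"
        have "openin (Z m) ?T"
          by (intro openin_Int openin_continuous_map_preimage[OF coord]
              openin_continuous_map_preimage[OF G_cont U]) auto
        then show ?thesis
          using z N G_eq[of _ N] by (intro exI[of _ ?T]) auto
      next
        case True
        then have "x \<in> U" using z S_end by simp
        with null[OF U] obtain N where N: "\<And>j. j \<ge> N \<Longrightarrow> H j ` topspace (Z m) \<subseteq> U"
          by (auto simp: MOST_nat_le)
        \<comment> \<open>Beyond this wall only terms of index at least \<open>N\<close> occur, and
          the last face itself goes to \<open>x\<close>.\<close>
        let ?T = "{z \<in> topspace (Z m). snd z 0 \<in> {real N / (real N + 1)<..}}"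
        have "openin (Z m) ?T"
          by (intro openin_continuous_map_preimage[OF coord]) auto
        moreover have "S w \<in> U" if w: "w \<in> topspace (Z m)" "real N / (real N + 1) < snd w 0" for w
        proof (cases "snd w 0 = 1")
          case False
          then have "snd w 0 < 1" using Zs[OF w(1)] by simp
          with Zs(4)[OF w(1)] obtain j where j: "j = 0 \<and> 0 \<le> snd w 0 \<or> real j / (real j + 1) < snd w 0"
            "snd w 0 \<le> (real j + 1) / (real j + 2)"
            by (rule slab_exists)
          have "N \<le> j"
          proof (rule ccontr)
            assume "\<not> N \<le> j"
            then have "(real j + 1) / (real j + 2) \<le> real N / (real N + 1)"
              using slab_le[of "j + 1" N] by (simp add: add.commute)
            with j w show False by linarith
          qed
          moreover have "S w = H j (fst w, (snd w)(0 := c j (snd w 0)))"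
            unfolding S_def c_def using j by (intro infinite_sum_slab) auto
          moreover have "(fst w, (snd w)(0 := c j (snd w 0))) \<in> topspace (Z m)"
            using Zs[OF w(1)] m slab_coordinate[OF j] by (auto simp: Z_def c_def intro!: unit_cube_upd)
          ultimately show ?thesis using N by blast
        qed (use S_end \<open>x \<in> U\<close> in simp)
        ultimately show ?thesis
          using z True by (intro exI[of _ ?T]) (auto simp: field_simps)
      qed
    qed
  qed
  then show ?thesis
    unfolding Z_def
  proof (rule loop_homotopicI)
    fix t :: real and s
    assume t: "0 \<le> t" "t \<le> 1" and s: "s \<in> cube_boundary m"
    have s': "s \<in> topspace (unit_cube m)" using s cube_boundary_subset by blast
    show "S (t, s) = x"
    proof (cases "s 0 = 1")
      case False
      then have "0 \<le> s 0" "s 0 < 1" using unit_cube_nth[OF s' m] by auto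
      then obtain j d where d: "0 \<le> d" "d \<le> 1" "s 0 = 0 \<Longrightarrow> d = 0"
        and eq: "\<And>x (f :: nat \<Rightarrow> (nat \<Rightarrow> real) \<Rightarrow> 'a). infinite_sum x f s = f j (s(0 := d))"
        by (rule infinite_sum_term) blast
      have "s(0 := d) \<in> cube_boundary m"
        using s m d False by (intro cube_boundary_upd) auto
      then show ?thesis using bd[OF t] by (simp add: S_def eq)
    qed (simp add: S_def infinite_sum_one)
  qed (simp_all add: S_def)
qed

lemma null_sequences_loops: "f \<in> null_sequences m X x \<Longrightarrow> f j \<in> loops m X x"
  by (simp add: null_sequences_def)

lemma null_sequences_eventually:
  "f \<in> null_sequences m X x \<Longrightarrow> openin X U \<Longrightarrow> x \<in> U \<Longrightarrow> \<forall>\<^sub>\<infinity>j. f j ` topspace (unit_cube m) \<subseteq> U"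
  by (simp add: null_sequences_def)

text \<open>Finitely many homotopies of any size are harmless, because the smallness condition
  ignores initial terms.\<close>

lemma infinite_sum_replace_initial:
  assumes x: "x \<in> topspace X" and m: "m > 0" and f: "f \<in> null_sequences m X x"
    and hom: "\<And>j. j < N \<Longrightarrow> loop_homotopic m X x (f j) (g j)"
  shows "loop_homotopic m X x (infinite_sum x f) (infinite_sum x (\<lambda>j. if j < N then g j else f j))"
proof -
  let ?Z = "prod_topology unit_interval (unit_cube m)"
  have "\<forall>j\<in>{..<N}. \<exists>h. continuous_map ?Z X h \<and> (\<forall>s\<in>topspace (unit_cube m). h (0, s) = f j s) \<and>
      (\<forall>s\<in>topspace (unit_cube m). h (1, s) = g j s) \<and> (\<forall>t\<in>{0..1}. \<forall>s\<in>cube_boundary m. h (t, s) = x)"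
    using hom by (simp add: loop_homotopic_iff)
  from bchoice[OF this] obtain h where "\<forall>j\<in>{..<N}. continuous_map ?Z X (h j) \<and>
      (\<forall>s\<in>topspace (unit_cube m). h j (0, s) = f j s) \<and>
      (\<forall>s\<in>topspace (unit_cube m). h j (1, s) = g j s) \<and> (\<forall>t\<in>{0..1}. \<forall>s\<in>cube_boundary m. h j (t, s) = x)"
    by blast
  then have h: "\<And>j. j < N \<Longrightarrow> continuous_map ?Z X (h j)"
    "\<And>j s. j < N \<Longrightarrow> s \<in> topspace (unit_cube m) \<Longrightarrow> h j (0, s) = f j s"
    "\<And>j s. j < N \<Longrightarrow> s \<in> topspace (unit_cube m) \<Longrightarrow> h j (1, s) = g j s"
    "\<And>j t s. j < N \<Longrightarrow> 0 \<le> t \<Longrightarrow> t \<le> 1 \<Longrightarrow> s \<in> cube_boundary m \<Longrightarrow> h j (t, s) = x"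
    by simp_all
  \<comment> \<open>From index \<open>N\<close> on the homotopy is stationary and therefore as small
    as the terms of \<open>f\<close>.\<close>
  let ?H = "\<lambda>j. if j < N then h j else f j \<circ> snd"
  have H: "loop_homotopic m X x (infinite_sum x (\<lambda>j s. ?H j (0, s))) (infinite_sum x (\<lambda>j s. ?H j (1, s)))"
  proof (rule infinite_sum_homotopic[OF x m])
    show "continuous_map ?Z X (?H j)" for j
      using h(1) by (auto intro: continuous_map_compose[OF continuous_map_snd
            loops_continuous[OF null_sequences_loops[OF f]]])
    show "?H j (t, s) = x" if "0 \<le> t" "t \<le> 1" "s \<in> cube_boundary m" for j t s
      using that h(4) loops_boundary[OF null_sequences_loops[OF f]] by simp
    fix U assume "openin X U" "x \<in> U"
    with f have "\<forall>\<^sub>\<infinity>j. f j ` topspace (unit_cube m) \<subseteq> U"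
      by (rule null_sequences_eventually)
    moreover have "\<forall>\<^sub>\<infinity>j. j \<ge> N" by (simp add: MOST_nat_le) blast
    ultimately show "\<forall>\<^sub>\<infinity>j. ?H j ` topspace ?Z \<subseteq> U"
      by eventually_elim auto
  qed
  \<comment> \<open>The chosen homotopies begin and end at the given loops only on the cube, so the
    sums have to be compared there.\<close>
  have *: "infinite_sum x F s = infinite_sum x F' s"
    if "\<And>j s. s \<in> topspace (unit_cube m) \<Longrightarrow> F j s = F' j s" "s \<in> topspace (unit_cube m)"
    for F F' :: "nat \<Rightarrow> (nat \<Rightarrow> real) \<Rightarrow> 'a" and s
  proof (cases "s 0 = 1")
    case False
    then have "0 \<le> s 0" "s 0 < 1" using unit_cube_nth[OF that(2) m] by auto
    then obtain j d where d: "0 \<le> d" "d \<le> 1"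
      and eq: "\<And>x (f :: nat \<Rightarrow> (nat \<Rightarrow> real) \<Rightarrow> 'a). infinite_sum x f s = f j (s(0 := d))"
      by (rule infinite_sum_term) blast
    have "s(0 := d) \<in> topspace (unit_cube m)"
      using m d that(2) by (intro unit_cube_upd)
    then show ?thesis by (simp add: eq that(1))
  qed (simp add: infinite_sum_one)
  have "loop_homotopic m X x (infinite_sum x (\<lambda>j s. ?H j (0, s))) (infinite_sum x f)"
    by (intro loop_homotopic_equal loop_homotopic_imp_loops(1)[OF H] *) (auto simp: h)
  then have "loop_homotopic m X x (infinite_sum x f) (infinite_sum x (\<lambda>j s. ?H j (0, s)))"
    by (rule loop_homotopic_sym)
  also note H
  also have "loop_homotopic m X x (infinite_sum x (\<lambda>j s. ?H j (1, s)))
      (infinite_sum x (\<lambda>j. if j < N then g j else f j))"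
    by (intro loop_homotopic_equal loop_homotopic_imp_loops(2)[OF H] *) (auto simp: h)
  finally show ?thesis .
qed

text \<open>Replacing no term at all still yields a homotopy that starts at the sum, and ends of
  such homotopies are loops.\<close>

lemma infinite_sum_loops:
  assumes "x \<in> topspace X" "m > 0" "f \<in> null_sequences m X x"
  shows "infinite_sum x f \<in> loops m X x"
  by (rule loop_homotopic_imp_loops(1)[OF infinite_sum_replace_initial[OF assms, where N=0]]) simp

lemma infinite_sum_image:
  assumes m: "m > 0" and x: "x \<in> U" and f: "\<And>j. f j ` topspace (unit_cube m) \<subseteq> U"
  shows "infinite_sum x f ` topspace (unit_cube m) \<subseteq> U"
proof safe
  fix s assume s: "s \<in> topspace (unit_cube m)"
  show "infinite_sum x f s \<in> U"
  proof (cases "s 0 = 1")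
    case False
    then have "0 \<le> s 0" "s 0 < 1" using unit_cube_nth[OF s m] by auto
    then obtain j d where d: "0 \<le> d" "d \<le> 1"
      and eq: "\<And>x (f :: nat \<Rightarrow> (nat \<Rightarrow> real) \<Rightarrow> 'a). infinite_sum x f s = f j (s(0 := d))"
      by (rule infinite_sum_term) blast
    have "s(0 := d) \<in> topspace (unit_cube m)"
      using m d s by (intro unit_cube_upd)
    then show ?thesis unfolding eq using f[of j] by blast
  qed (simp add: infinite_sum_one x)
qed

lemma compose_infinite_sum: "h \<circ> infinite_sum x f = infinite_sum (h x) (\<lambda>j. h \<circ> f j)"
  by (auto simp: infinite_sum_def Let_def)

lemma null_sequences_compose:
  assumes f: "f \<in> null_sequences m X x" and h: "continuous_map X Y h" and x: "x \<in> topspace X"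
  shows "(\<lambda>j. h \<circ> f j) \<in> null_sequences m Y (h x)"
  unfolding null_sequences_def
proof (intro CollectI conjI allI impI)
  show "h \<circ> f j \<in> loops m Y (h x)" for j
    using loops_compose[OF null_sequences_loops[OF f] h] .
  fix U assume U: "openin Y U \<and> h x \<in> U"
  then have "openin X {a \<in> topspace X. h a \<in> U}"
    using h openin_continuous_map_preimage by blast
  then have "\<forall>\<^sub>\<infinity>j. f j ` topspace (unit_cube m) \<subseteq> {a \<in> topspace X. h a \<in> U}"
    by (rule null_sequences_eventually[OF f]) (use U x in simp)
  then show "\<forall>\<^sub>\<infinity>j. (h \<circ> f j) ` topspace (unit_cube m) \<subseteq> U"
    by eventually_elim auto
qed

text \<open>An equality of functions rather than a homotopy, since the two constructions alter
  different coordinates.\<close>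

lemma infinite_sum_add_along:
  assumes "i \<noteq> 0"
  shows "add_along i (infinite_sum x f) (infinite_sum x g) = infinite_sum x (\<lambda>j. add_along i (f j) (g j))"
  using assms by (auto simp: add_along_def infinite_sum_def Let_def fun_upd_twist)

lemma infinite_sum_reverse_along:
  assumes "i \<noteq> 0"
  shows "reverse_along i (infinite_sum x f) = infinite_sum x (\<lambda>j. reverse_along i (f j))"
  using assms by (auto simp: reverse_along_def infinite_sum_def Let_def fun_upd_twist)

lemma null_sequences_add_along:
  assumes f: "f \<in> null_sequences m X x" and g: "g \<in> null_sequences m X x" and i: "i < m"
  shows "(\<lambda>j. add_along i (f j) (g j)) \<in> null_sequences m X x"
  unfolding null_sequences_def
proof (intro CollectI conjI allI impI)
  show "add_along i (f j) (g j) \<in> loops m X x" for j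
    using assms by (intro add_along_loops null_sequences_loops)
  have *: "add_along i (f j) (g j) ` topspace (unit_cube m)
      \<subseteq> f j ` topspace (unit_cube m) \<union> g j ` topspace (unit_cube m)" for j
  proof safe
    fix s assume s: "s \<in> topspace (unit_cube m)" "add_along i (f j) (g j) s \<notin> g j ` topspace (unit_cube m)"
    then have "s i \<le> 1/2"
      using unit_cube_nth[OF s(1) i] unit_cube_upd[OF s(1) i, of "2 * s i - 1"]
      by (auto simp: add_along_def split: if_splits)
    then show "add_along i (f j) (g j) s \<in> f j ` topspace (unit_cube m)"
      using unit_cube_nth[OF s(1) i] unit_cube_upd[OF s(1) i, of "2 * s i"] by (auto simp: add_along_def)
  qed
  fix U assume "openin X U \<and> x \<in> U"
  then have "\<forall>\<^sub>\<infinity>j. f j ` topspace (unit_cube m) \<subseteq> U" "\<forall>\<^sub>\<infinity>j. g j ` topspace (unit_cube m) \<subseteq> U"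
    using null_sequences_eventually[OF f, of U] null_sequences_eventually[OF g, of U] by auto
  then show "\<forall>\<^sub>\<infinity>j. add_along i (f j) (g j) ` topspace (unit_cube m) \<subseteq> U"
    by eventually_elim (use * in blast)
qed

lemma null_sequences_reverse_along:
  assumes f: "f \<in> null_sequences m X x" and i: "i < m"
  shows "(\<lambda>j. reverse_along i (f j)) \<in> null_sequences m X x"
  unfolding null_sequences_def
proof (intro CollectI conjI allI impI)
  show "reverse_along i (f j) \<in> loops m X x" for j
    using assms by (intro reverse_along_loops null_sequences_loops)
  have *: "reverse_along i (f j) ` topspace (unit_cube m) \<subseteq> f j ` topspace (unit_cube m)" for j
    using unit_cube_upd[OF _ i] unit_cube_nth[OF _ i] by (auto simp: reverse_along_def)
  fix U assume "openin X U \<and> x \<in> U"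
  then have "\<forall>\<^sub>\<infinity>j. f j ` topspace (unit_cube m) \<subseteq> U"
    using null_sequences_eventually[OF f, of U] by auto
  then show "\<forall>\<^sub>\<infinity>j. reverse_along i (f j) ` topspace (unit_cube m) \<subseteq> U"
    by eventually_elim (use * in blast)
qed

text \<open>Sums and inverses are formed along the second coordinate, where they commute with infinite sums.\<close>

lemma subgroup_infinite_sum_classes:
  assumes x: "x \<in> topspace X" and m: "m > 1" and S: "S \<subseteq> carrier (homotopy_group m X x)"
  shows "subgroup (infinite_sum_classes m X x S) (homotopy_group m X x)"
proof -
  let ?G = "homotopy_group m X x"
  let ?A = "generate ?G S"
  interpret G: group ?G
    using x m by (intro group_homotopy_group) auto
  interpret A: subgroup ?A ?G
    using S by (rule G.generate_is_subgroup)
  have [simp]: "infinite_sum x f \<in> loops m X x" if "f \<in> null_sequences m X x" for f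
    using infinite_sum_loops x m that by fastforce
  have mult: "loop_class m X x (f j) \<otimes>\<^bsub>?G\<^esub> loop_class m X x (g j) = loop_class m X x (add_along 1 (f j) (g j))"
    if "f \<in> null_sequences m X x" "g \<in> null_sequences m X x" for f g and j :: nat
    using that m by (intro mult_homotopy_group null_sequences_loops)
  show ?thesis
  proof (rule G.subgroupI)
    show "infinite_sum_classes m X x S \<subseteq> carrier ?G"
      by (auto simp: infinite_sum_classes_def carrier_homotopy_group)
    have "(\<lambda>j s. x) \<in> null_sequences m X x"
      using x by (auto simp: null_sequences_def loops_const)
    moreover have "loop_class m X x (\<lambda>s. x) \<in> ?A"
      using A.one_closed by (simp add: one_homotopy_group)
    ultimately show "infinite_sum_classes m X x S \<noteq> {}"
      unfolding infinite_sum_classes_def by blast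
    show "inv\<^bsub>?G\<^esub> a \<in> infinite_sum_classes m X x S" if a: "a \<in> infinite_sum_classes m X x S" for a
    proof -
      obtain f where f: "f \<in> null_sequences m X x" "\<And>j. loop_class m X x (f j) \<in> ?A"
        "a = loop_class m X x (infinite_sum x f)"
        using a by (auto simp: infinite_sum_classes_def)
      have inv: "inv\<^bsub>?G\<^esub> (loop_class m X x g) = loop_class m X x (reverse_along 1 g)" if "g \<in> loops m X x" for g
        using x that m by (rule inv_homotopy_group)
      have "inv\<^bsub>?G\<^esub> a = loop_class m X x (infinite_sum x (\<lambda>j. reverse_along 1 (f j)))"
        using f by (simp add: inv infinite_sum_reverse_along)
      moreover have "loop_class m X x (reverse_along 1 (f j)) \<in> ?A" for j
        using f A.m_inv_closed[OF f(2)] inv[OF null_sequences_loops[OF f(1)]] by metis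
      ultimately show ?thesis
        using null_sequences_reverse_along[OF f(1) m] unfolding infinite_sum_classes_def by blast
    qed
    show "a \<otimes>\<^bsub>?G\<^esub> b \<in> infinite_sum_classes m X x S"
      if a: "a \<in> infinite_sum_classes m X x S" and b: "b \<in> infinite_sum_classes m X x S" for a b
    proof -
      obtain f where f: "f \<in> null_sequences m X x" "\<And>j. loop_class m X x (f j) \<in> ?A"
        "a = loop_class m X x (infinite_sum x f)"
        using a by (auto simp: infinite_sum_classes_def)
      obtain g where g: "g \<in> null_sequences m X x" "\<And>j. loop_class m X x (g j) \<in> ?A"
        "b = loop_class m X x (infinite_sum x g)"
        using b by (auto simp: infinite_sum_classes_def)
      have "a \<otimes>\<^bsub>?G\<^esub> b = loop_class m X x (infinite_sum x (\<lambda>j. add_along 1 (f j) (g j)))"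
        using f g m by (simp add: mult_homotopy_group[where i=1] infinite_sum_add_along)
      moreover have "loop_class m X x (add_along 1 (f j) (g j)) \<in> ?A" for j
        using A.m_closed[OF f(2) g(2), of j j] mult[OF f(1) g(1)] by simp
      ultimately show ?thesis
        using null_sequences_add_along[OF f(1) g(1) m] unfolding infinite_sum_classes_def by blast
    qed
  qed
qed

section \<open>Whitehead products\<close>

definition cube_corner :: "nat \<Rightarrow> nat \<Rightarrow> real"
  where "cube_corner m = (\<lambda>i\<in>{..<m}. 0)"

lemma cube_corner_boundary: "m > 0 \<Longrightarrow> cube_corner m \<in> cube_boundary m"
  by (auto simp: cube_boundary_def cube_corner_def topspace_unit_cube)

lemma closedin_cube_boundary: "closedin (unit_cube m) (cube_boundary m)"
proof -
  have "cube_boundary m = (\<Union>i<m. {s \<in> topspace (unit_cube m). s i \<in> {0, 1}})"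
    by (auto simp: cube_boundary_def)
  moreover have "closedin (unit_cube m) {s \<in> topspace (unit_cube m). s i \<in> {0, 1}}" if "i < m" for i
    by (rule closedin_continuous_map_preimage[of _ euclideanreal])
      (use continuous_map_unit_cube_nth[OF continuous_map_id that] in auto)
  ultimately show ?thesis
    by (metis (no_types, lifting) closedin_Union finite_imageI finite_lessThan imageE lessThan_iff)
qed

definition cube_radius :: "nat \<Rightarrow> (nat \<Rightarrow> real) \<Rightarrow> real"
  where "cube_radius m s = Max ((\<lambda>i. \<bar>2 * s i - 1\<bar>) ` {..<m})"

definition chart_vector :: "nat \<Rightarrow> (nat \<Rightarrow> real) \<Rightarrow> nat \<Rightarrow> real"
  where "chart_vector m s i =
    (case i of 0 \<Rightarrow> 0 | Suc k \<Rightarrow> (1 - cube_radius m s) * (2 * s k - 1)) + (1 - 2 * cube_radius m s)"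

definition chart_norm :: "nat \<Rightarrow> (nat \<Rightarrow> real) \<Rightarrow> real"
  where "chart_norm m s = Max ((\<lambda>i. \<bar>chart_vector m s i\<bar>) ` {..<Suc m})"

lemma sphere_chart_eq:
  "sphere_chart m s = (\<lambda>i\<in>{..<Suc m}. (1 + chart_vector m s i / chart_norm m s) / 2)"
  unfolding sphere_chart_def Let_def cube_radius_def chart_vector_def chart_norm_def by (rule refl)

lemma cube_radius_ge: "i < m \<Longrightarrow> \<bar>2 * s i - 1\<bar> \<le> cube_radius m s"
  by (auto simp: cube_radius_def)

lemma cube_radius_attained:
  assumes "m > 0"
  obtains i where "i < m" "cube_radius m s = \<bar>2 * s i - 1\<bar>"
proof -
  have "cube_radius m s \<in> (\<lambda>i. \<bar>2 * s i - 1\<bar>) ` {..<m}"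
    unfolding cube_radius_def using assms by (intro Max_in) auto
  then show ?thesis using that by auto
qed

lemma cube_radius_le_1: "m > 0 \<Longrightarrow> s \<in> topspace (unit_cube m) \<Longrightarrow> cube_radius m s \<le> 1"
  using cube_radius_attained[of m s] unit_cube_nth[of s m] by (smt (verit))

lemma cube_radius_boundary:
  assumes "s \<in> cube_boundary m"
  shows "cube_radius m s = 1"
proof -
  obtain i where i: "i < m" "s i = 0 \<or> s i = 1" and s: "s \<in> topspace (unit_cube m)"
    using assms by (auto simp: cube_boundary_def)
  then have "1 \<le> cube_radius m s"
    using cube_radius_ge[of i m s] by auto
  then show ?thesis
    using cube_radius_le_1[OF _ s] i by auto
qed

lemma continuous_map_cube_radius: "continuous_map (unit_cube m) euclideanreal (cube_radius m)"
  unfolding cube_radius_def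
  by (intro continuous_map_Max continuous_intros)
    (use continuous_map_unit_cube_nth[OF continuous_map_id] in auto)

lemma chart_norm_ge: "i < Suc m \<Longrightarrow> \<bar>chart_vector m s i\<bar> \<le> chart_norm m s"
  unfolding chart_norm_def by (intro Max_ge) auto

text \<open>A zero vector would force radius 1/2 by its first coordinate and then, by the others,
  the centre of the cube, whose radius is 0. Hence the radial projection in the chart never divides
  by zero.\<close>

lemma chart_norm_pos:
  assumes m: "m > 0"
  shows "chart_norm m s > 0"
proof (rule ccontr)
  assume "\<not> 0 < chart_norm m s"
  then have zero: "chart_vector m s i = 0" if "i < Suc m" for i
    using chart_norm_ge[OF that, of s] by linarith
  have r: "cube_radius m s = 1/2"
    using zero[of 0] by (simp add: chart_vector_def)
  obtain i where i: "i < m" "cube_radius m s = \<bar>2 * s i - 1\<bar>"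
    using cube_radius_attained[OF m] by blast
  have "2 * s i - 1 = 0"
    using zero[of "Suc i"] i(1) r by (simp add: chart_vector_def)
  with i r show False by simp
qed

lemma sphere_chart_mem:
  assumes m: "m > 0"
  shows "sphere_chart m s \<in> cube_boundary (Suc m)"
proof -
  have "chart_norm m s \<in> (\<lambda>i. \<bar>chart_vector m s i\<bar>) ` {..<Suc m}"
    unfolding chart_norm_def by (intro Max_in) auto
  then obtain i where i: "i < Suc m" "chart_norm m s = \<bar>chart_vector m s i\<bar>"
    by auto
  then have "chart_vector m s i / chart_norm m s = 1 \<or> chart_vector m s i / chart_norm m s = - 1"
    using chart_norm_pos[OF m, of s] by (cases "chart_vector m s i \<ge> 0") (auto simp: field_simps)
  then have "sphere_chart m s i = 0 \<or> sphere_chart m s i = 1"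
    using i(1) by (auto simp: sphere_chart_eq)
  moreover have "0 \<le> 1 + chart_vector m s k / chart_norm m s \<and> chart_vector m s k / chart_norm m s \<le> 1"
    if "k < Suc m" for k
    using chart_norm_ge[OF that, of s] chart_norm_pos[OF m, of s]
    by (simp add: field_simps abs_le_iff)
  then have "0 \<le> sphere_chart m s k \<and> sphere_chart m s k \<le> 1" if "k < Suc m" for k
    unfolding sphere_chart_eq using that by auto
  then have "sphere_chart m s \<in> topspace (unit_cube (Suc m))"
    by (auto simp: sphere_chart_eq topspace_unit_cube)
  ultimately show ?thesis
    using i(1) by (auto simp: cube_boundary_def)
qed

text \<open>At radius 1 the direction term vanishes and only the multiple -1 of the diagonal is
  left, which projects to the corner.\<close>

lemma sphere_chart_boundary:
  assumes "s \<in> cube_boundary m"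
  shows "sphere_chart m s = cube_corner (Suc m)"
proof -
  have v: "chart_vector m s i = - 1" for i
    by (simp add: chart_vector_def cube_radius_boundary[OF assms] split: nat.split)
  then have "chart_norm m s = 1"
    by (simp add: chart_norm_def image_constant_conv lessThan_empty_iff)
  with v show ?thesis
    by (simp add: sphere_chart_eq cube_corner_def restrict_def fun_eq_iff)
qed

lemma continuous_map_sphere_chart:
  assumes m: "m > 0"
  shows "continuous_map (unit_cube m) (unit_cube (Suc m)) (sphere_chart m)"
proof (rule continuous_map_unit_cubeI)
  have v: "continuous_map (unit_cube m) euclideanreal (\<lambda>s. chart_vector m s i)" if "i < Suc m" for i
  proof (cases i)
    case 0
    then show ?thesis
      unfolding chart_vector_def by (auto intro!: continuous_intros continuous_map_cube_radius)
  next
    case (Suc k)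
    then have "continuous_map (unit_cube m) euclideanreal (\<lambda>s. s k)"
      using that continuous_map_unit_cube_nth[OF continuous_map_id] by auto
    with Suc show ?thesis
      unfolding chart_vector_def by (auto intro!: continuous_intros continuous_map_cube_radius)
  qed
  have "continuous_map (unit_cube m) euclideanreal (chart_norm m)"
    unfolding chart_norm_def by (intro continuous_map_Max continuous_intros v)
  moreover have "chart_norm m s \<noteq> 0" for s
    using chart_norm_pos[OF m, of s] by simp
  ultimately show "continuous_map (unit_cube m) euclideanreal (\<lambda>s. sphere_chart m s i)" if "i < Suc m" for i
    using v[OF that] that by (auto simp: sphere_chart_eq intro!: continuous_intros)
  show "0 \<le> sphere_chart m s i \<and> sphere_chart m s i \<le> 1" if "i < Suc m" for s i
    by (rule unit_cube_nth[OF _ that]) (use sphere_chart_mem[OF m] cube_boundary_subset in blast)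
qed (simp add: sphere_chart_eq)

section \<open>Coordinate parts of the chart and Whitehead loops\<close>

definition left_part :: "nat \<Rightarrow> (nat \<Rightarrow> real) \<Rightarrow> nat \<Rightarrow> real"
  where "left_part p z = restrict z {..<p}"

definition right_part :: "nat \<Rightarrow> nat \<Rightarrow> (nat \<Rightarrow> real) \<Rightarrow> nat \<Rightarrow> real"
  where "right_part p q z = (\<lambda>i\<in>{..<q}. z (p + i))"

lemma continuous_map_left_part: "continuous_map (unit_cube (p + q)) (unit_cube p) (left_part p)"
  using continuous_map_unit_cube_nth[OF continuous_map_id, of _ "p + q"]
  by (intro continuous_map_unit_cubeI) (auto simp: left_part_def unit_cube_nth[of _ "p + q"])

lemma continuous_map_right_part: "continuous_map (unit_cube (p + q)) (unit_cube q) (right_part p q)"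
  using continuous_map_unit_cube_nth[OF continuous_map_id, of _ "p + q"]
  by (intro continuous_map_unit_cubeI) (auto simp: right_part_def unit_cube_nth[of _ "p + q"])

lemma parts_cube_corner:
  "left_part p (cube_corner (p + q)) = cube_corner p" "right_part p q (cube_corner (p + q)) = cube_corner q"
  by (auto simp: left_part_def right_part_def cube_corner_def)

lemma parts_boundary:
  assumes z: "z \<in> cube_boundary (p + q)"
  shows "left_part p z \<in> cube_boundary p \<or> right_part p q z \<in> cube_boundary q"
proof -
  have z': "z \<in> topspace (unit_cube (p + q))"
    using z cube_boundary_subset by blast
  have *: "left_part p z \<in> topspace (unit_cube p)" "right_part p q z \<in> topspace (unit_cube q)"
    using continuous_map_image_subset_topspace[OF continuous_map_left_part[of p q]]
      continuous_map_image_subset_topspace[OF continuous_map_right_part[of p q]] z'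
    by (auto simp: image_subset_iff)
  from z obtain i where i: "i < p + q" "z i = 0 \<or> z i = 1"
    by (auto simp: cube_boundary_def)
  show ?thesis
  proof (cases "i < p")
    case True
    then show ?thesis using i * by (auto simp: cube_boundary_def left_part_def)
  next
    case False
    then have "right_part p q z (i - p) = z i" "i - p < q"
      using i(1) by (auto simp: right_part_def)
    then show ?thesis using i * unfolding cube_boundary_def by auto
  qed
qed

text \<open>These two maps of cubes carry the whole geometry of a Whitehead loop: on two closed
  pieces it is \<open>f\<close> after the first or \<open>g\<close> after the second.\<close>

definition chart_left :: "nat \<Rightarrow> nat \<Rightarrow> (nat \<Rightarrow> real) \<Rightarrow> nat \<Rightarrow> real"
  where "chart_left p q s = left_part p (sphere_chart (p + q - 1) s)"

definition chart_right :: "nat \<Rightarrow> nat \<Rightarrow> (nat \<Rightarrow> real) \<Rightarrow> nat \<Rightarrow> real"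
  where "chart_right p q s = right_part p q (sphere_chart (p + q - 1) s)"

lemma whitehead_loop_eq:
  "whitehead_loop p q f g s =
    (if chart_right p q s \<in> cube_boundary q then f (chart_left p q s) else g (chart_right p q s))"
  by (simp add: whitehead_loop_def wedge_attach_def chart_left_def chart_right_def
      left_part_def right_part_def Let_def)

lemma compose_whitehead_loop: "h \<circ> whitehead_loop p q f g = whitehead_loop p q (h \<circ> f) (h \<circ> g)"
  by (simp add: whitehead_loop_eq fun_eq_iff)

context
  fixes p q :: nat
  assumes p: "p > 0" and q: "q > 0"
begin

lemma continuous_map_chart_parts:
  "continuous_map (unit_cube (p + q - 1)) (unit_cube p) (chart_left p q)"
  "continuous_map (unit_cube (p + q - 1)) (unit_cube q) (chart_right p q)"
proof -
  have "continuous_map (unit_cube (p + q - 1)) (unit_cube (p + q)) (sphere_chart (p + q - 1))"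
    using continuous_map_sphere_chart[of "p + q - 1"] p q by simp
  from continuous_map_compose[OF this continuous_map_left_part]
    continuous_map_compose[OF this continuous_map_right_part]
  show "continuous_map (unit_cube (p + q - 1)) (unit_cube p) (chart_left p q)"
    "continuous_map (unit_cube (p + q - 1)) (unit_cube q) (chart_right p q)"
    by (simp_all add: chart_left_def[abs_def] chart_right_def[abs_def] o_def)
qed

lemma chart_parts_boundary:
  "chart_left p q s \<in> cube_boundary p \<or> chart_right p q s \<in> cube_boundary q"
  using parts_boundary[of "sphere_chart (p + q - 1) s" p q] sphere_chart_mem[of "p + q - 1" s] p q
  by (simp add: chart_left_def chart_right_def)

lemma chart_parts_corner:
  assumes "s \<in> cube_boundary (p + q - 1)"
  shows "chart_left p q s = cube_corner p" "chart_right p q s = cube_corner q"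
  using sphere_chart_boundary[OF assms] parts_cube_corner[of p q] p
  by (simp_all add: chart_left_def chart_right_def)

lemma whitehead_loop_homotopic:
  assumes f: "loop_homotopic p X x f f'" and g: "loop_homotopic q X x g g'"
  shows "loop_homotopic (p + q - 1) X x (whitehead_loop p q f g) (whitehead_loop p q f' g')"
proof -
  let ?Z = "prod_topology unit_interval (unit_cube (p + q - 1))"
  from f obtain H where H: "continuous_map (prod_topology unit_interval (unit_cube p)) X H"
    "\<And>s. s \<in> topspace (unit_cube p) \<Longrightarrow> H (0, s) = f s"
    "\<And>s. s \<in> topspace (unit_cube p) \<Longrightarrow> H (1, s) = f' s"
    "\<And>t s. 0 \<le> t \<Longrightarrow> t \<le> 1 \<Longrightarrow> s \<in> cube_boundary p \<Longrightarrow> H (t, s) = x"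
    by (rule loop_homotopicE) blast
  from g obtain K where K: "continuous_map (prod_topology unit_interval (unit_cube q)) X K"
    "\<And>s. s \<in> topspace (unit_cube q) \<Longrightarrow> K (0, s) = g s"
    "\<And>s. s \<in> topspace (unit_cube q) \<Longrightarrow> K (1, s) = g' s"
    "\<And>t s. 0 \<le> t \<Longrightarrow> t \<le> 1 \<Longrightarrow> s \<in> cube_boundary q \<Longrightarrow> K (t, s) = x"
    by (rule loop_homotopicE) blast
  let ?l = "\<lambda>z. chart_left p q (snd z)" and ?r = "\<lambda>z. chart_right p q (snd z)"
  let ?h = "\<lambda>z. if ?r z \<in> cube_boundary q then H (fst z, ?l z) else K (fst z, ?r z)"
  have l: "continuous_map ?Z (unit_cube p) ?l" and r: "continuous_map ?Z (unit_cube q) ?r"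
    using continuous_map_compose[OF continuous_map_snd continuous_map_chart_parts(1)]
      continuous_map_compose[OF continuous_map_snd continuous_map_chart_parts(2)]
    unfolding o_def by blast+
  have HZ: "continuous_map ?Z X (\<lambda>z. H (fst z, ?l z))" and KZ: "continuous_map ?Z X (\<lambda>z. K (fst z, ?r z))"
    using continuous_map_pair_arg[OF H(1) continuous_map_fst l]
      continuous_map_pair_arg[OF K(1) continuous_map_fst r] by blast+
  have "continuous_map ?Z X ?h"
  \<comment> \<open>The two closed pieces are given by which part lies on the boundary of its cube.
    They cover the domain by \<open>chart_parts_boundary\<close>, and where they overlap both
    formulas give \<open>x\<close>.\<close>
  proof (rule pasting_lemma_closed[where I=UNIV
        and T="\<lambda>b. if b then {z \<in> topspace ?Z. ?r z \<in> cube_boundary q} else {z \<in> topspace ?Z. ?l z \<in> cube_boundary p}"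
        and f="\<lambda>b. if b then (\<lambda>z. H (fst z, ?l z)) else (\<lambda>z. K (fst z, ?r z))"])
    show "closedin ?Z (if b then {z \<in> topspace ?Z. ?r z \<in> cube_boundary q}
        else {z \<in> topspace ?Z. ?l z \<in> cube_boundary p})" for b
      using closedin_continuous_map_preimage[OF l closedin_cube_boundary]
        closedin_continuous_map_preimage[OF r closedin_cube_boundary] by presburger
    show "\<exists>b. b \<in> UNIV \<and>
        z \<in> (if b then {z \<in> topspace ?Z. ?r z \<in> cube_boundary q} else {z \<in> topspace ?Z. ?l z \<in> cube_boundary p}) \<and>
        ?h z = (if b then (\<lambda>z. H (fst z, ?l z)) else (\<lambda>z. K (fst z, ?r z))) z" if "z \<in> topspace ?Z" for z
      using chart_parts_boundary[of "snd z"] that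
      by (intro exI[of _ "?r z \<in> cube_boundary q"]) auto
  qed (use HZ KZ H(4) K(4) in \<open>auto intro!: continuous_map_from_subtopology split: if_splits\<close>)
  then show ?thesis
  proof (rule loop_homotopicI)
    fix s assume "s \<in> topspace (unit_cube (p + q - 1))"
    then have "chart_left p q s \<in> topspace (unit_cube p)" "chart_right p q s \<in> topspace (unit_cube q)"
      using continuous_map_image_subset_topspace[OF continuous_map_chart_parts(1)]
        continuous_map_image_subset_topspace[OF continuous_map_chart_parts(2)] by auto
    then show "?h (0, s) = whitehead_loop p q f g s" "?h (1, s) = whitehead_loop p q f' g' s"
      by (simp_all add: whitehead_loop_eq H K)
  next
    fix t :: real and s
    assume "0 \<le> t" "t \<le> 1" "s \<in> cube_boundary (p + q - 1)"
    then show "?h (t, s) = x"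
      by (simp add: chart_parts_corner cube_corner_boundary p q H(4))
  qed
qed

lemma whitehead_loop_loops:
  "f \<in> loops p X x \<Longrightarrow> g \<in> loops q X x \<Longrightarrow> whitehead_loop p q f g \<in> loops (p + q - 1) X x"
  using whitehead_loop_homotopic loop_homotopic_refl by metis

lemma whitehead_product_loop_class:
  assumes "f \<in> loops p X x" "g \<in> loops q X x"
  shows "whitehead_product p q X x (loop_class p X x f) (loop_class q X x g) =
    loop_class (p + q - 1) X x (whitehead_loop p q f g)"
  unfolding whitehead_product_def using assms by (intro Union_loop_class2 whitehead_loop_homotopic)

end

text \<open>The contraction takes place in the cube on which \<open>f\<close> is defined: scaling by
  \<open>1 - t\<close> moves \<phi> to the corner and fixes the corner, so the homotopy respects
  basepoints.\<close>

lemma loop_compose_nullhomotopic: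
  assumes f: "f \<in> loops p X x" and p: "p > 0"
    and \<phi>: "continuous_map (unit_cube m) (unit_cube p) \<phi>"
    and corner: "\<And>s. s \<in> cube_boundary m \<Longrightarrow> \<phi> s = cube_corner p"
  shows "loop_homotopic m X x (f \<circ> \<phi>) (\<lambda>s. x)"
proof (rule loop_homotopicI)
  let ?Z = "prod_topology unit_interval (unit_cube m)"
  let ?h = "\<lambda>z. \<lambda>i\<in>{..<p}. (1 - fst z) * \<phi> (snd z) i"
  have "continuous_map ?Z euclideanreal (\<lambda>z. \<phi> (snd z) i)" if "i < p" for i
    using continuous_map_unit_cube_nth[OF continuous_map_compose[OF continuous_map_snd \<phi>] that]
    unfolding o_def .
  moreover have "continuous_map ?Z euclideanreal fst"
    by (metis continuous_map_fst continuous_map_into_fulltopology)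
  ultimately have "continuous_map ?Z (unit_cube p) ?h"
    using continuous_map_image_subset_topspace[OF \<phi>]
    by (intro continuous_map_unit_cubeI)
      (auto intro!: continuous_intros mult_le_one simp: image_subset_iff unit_cube_nth)
  then show "continuous_map ?Z X (f \<circ> ?h)"
    using loops_continuous[OF f] by (rule continuous_map_compose)
next
  fix s assume "s \<in> topspace (unit_cube m)"
  then have "\<phi> s \<in> topspace (unit_cube p)"
    using continuous_map_image_subset_topspace[OF \<phi>] by blast
  then have "restrict (\<phi> s) {..<p} = \<phi> s"
    by (simp add: topspace_unit_cube)
  then show "(f \<circ> (\<lambda>z. \<lambda>i\<in>{..<p}. (1 - fst z) * \<phi> (snd z) i)) (0, s) = (f \<circ> \<phi>) s"
    by simp
  show "(f \<circ> (\<lambda>z. \<lambda>i\<in>{..<p}. (1 - fst z) * \<phi> (snd z) i)) (1, s) = x"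
    using loops_boundary[OF f cube_corner_boundary[OF p]] by (simp add: cube_corner_def)
next
  fix t s assume "s \<in> cube_boundary m"
  then have "(\<lambda>i\<in>{..<p}. (1 - t) * \<phi> s i) = cube_corner p"
    by (auto simp: corner cube_corner_def)
  then show "(f \<circ> (\<lambda>z. \<lambda>i\<in>{..<p}. (1 - fst z) * \<phi> (snd z) i)) (t, s) = x"
    using loops_boundary[OF f cube_corner_boundary[OF p]] by simp
qed

text \<open>If one factor is constant, the case distinction disappears and the loop becomes the
  other factor composed with a map into its cube.\<close>

lemma whitehead_loop_nullhomotopic:
  assumes p: "p > 0" and q: "q > 0" and f: "f \<in> loops p X x" and g: "g \<in> loops q X x"
    and const: "(\<forall>s\<in>topspace (unit_cube p). f s = x) \<or> (\<forall>t\<in>topspace (unit_cube q). g t = x)"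
  shows "loop_homotopic (p + q - 1) X x (whitehead_loop p q f g) (\<lambda>s. x)"
proof -
  note parts = continuous_map_chart_parts[OF p q]
  have mem: "chart_left p q s \<in> topspace (unit_cube p)" "chart_right p q s \<in> topspace (unit_cube q)"
    if "s \<in> topspace (unit_cube (p + q - 1))" for s
    using that continuous_map_image_subset_topspace[OF parts(1)]
      continuous_map_image_subset_topspace[OF parts(2)] by auto
  from const show ?thesis
  proof
    assume const: "\<forall>s\<in>topspace (unit_cube p). f s = x"
    have "whitehead_loop p q f g s = (g \<circ> chart_right p q) s" if "s \<in> topspace (unit_cube (p + q - 1))" for s
      using const mem[OF that] loops_boundary[OF g] by (simp add: whitehead_loop_eq)
    then have "loop_homotopic (p + q - 1) X x (whitehead_loop p q f g) (g \<circ> chart_right p q)"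
      by (intro loop_homotopic_equal whitehead_loop_loops p q f g)
    also have "loop_homotopic (p + q - 1) X x \<dots> (\<lambda>s. x)"
      using g q parts(2) chart_parts_corner(2)[OF p q] by (rule loop_compose_nullhomotopic)
    finally show ?thesis .
  next
    assume const: "\<forall>t\<in>topspace (unit_cube q). g t = x"
    \<comment> \<open>Where the right part is off the boundary, the left part lies on it, so
      \<open>f\<close> takes there the same value \<open>x\<close> as the constant
      \<open>g\<close>.\<close>
    have "whitehead_loop p q f g s = (f \<circ> chart_left p q) s" if "s \<in> topspace (unit_cube (p + q - 1))" for s
      using const mem[OF that] loops_boundary[OF f] chart_parts_boundary[OF p q, of s]
      by (auto simp: whitehead_loop_eq)
    then have "loop_homotopic (p + q - 1) X x (whitehead_loop p q f g) (f \<circ> chart_left p q)"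
      by (intro loop_homotopic_equal whitehead_loop_loops p q f g)
    also have "loop_homotopic (p + q - 1) X x \<dots> (\<lambda>s. x)"
      using f p parts(1) chart_parts_corner(1)[OF p q] by (rule loop_compose_nullhomotopic)
    finally show ?thesis .
  qed
qed

section \<open>Retractions of a shrinking wedge\<close>

lemma wedge_retraction_None: "wedge_retraction x j None = x j"
  by (simp add: wedge_retraction_def)

lemma wedge_retraction_inj: "wedge_retraction x j (wedge_inj x i a) = (if i = j then a else x j)"
  by (simp add: wedge_retraction_def wedge_inj_def)

lemma None_in_shrinking_wedge:
  assumes "\<And>j. x j \<in> topspace (X j)"
  shows "None \<in> topspace (shrinking_wedge X x)"
  using assms[of 0] by (auto simp: topspace_shrinking_wedge wedge_summand_def wedge_inj_def image_iff)

text \<open>The preimage of \<open>V\<close> meets summand \<open>j\<close> in \<open>V\<close> and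
  any other summand in all or none of it, according to whether \<open>x j\<close> lies in
  \<open>V\<close>. If it contains the basepoint, it therefore contains every summand except
  possibly the \<open>j\<close>-th.\<close>

lemma continuous_map_wedge_retraction:
  assumes base: "\<And>j. x j \<in> topspace (X j)"
  shows "continuous_map (shrinking_wedge X x) (X j) (wedge_retraction x j)"
  unfolding continuous_map_def
proof (intro conjI allI impI)
  show "wedge_retraction x j \<in> topspace (shrinking_wedge X x) \<rightarrow> topspace (X j)"
    using base by (auto simp: topspace_shrinking_wedge wedge_summand_def wedge_retraction_inj)
  fix V assume V: "openin (X j) V"
  let ?P = "{w \<in> topspace (shrinking_wedge X x). wedge_retraction x j w \<in> V}"
  have inj: "wedge_inj x i a \<in> topspace (shrinking_wedge X x)" if "a \<in> topspace (X i)" for i a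
    using that by (auto simp: topspace_shrinking_wedge wedge_summand_def)
  have "wedge_open X x ?P"
    unfolding wedge_open_def
  proof (intro conjI allI impI)
    show "?P \<subseteq> (\<Union>j. wedge_summand X x j)"
      by (auto simp: topspace_shrinking_wedge)
    show "openin (X i) {a \<in> topspace (X i). wedge_inj x i a \<in> ?P}" for i
    proof (cases "i = j")
      case True
      then have "{a \<in> topspace (X i). wedge_inj x i a \<in> ?P} = V"
        using openin_subset[OF V] inj by (auto simp: wedge_retraction_inj)
      then show ?thesis using V True by simp
    next
      case False
      then have "{a \<in> topspace (X i). wedge_inj x i a \<in> ?P} = (if x j \<in> V then topspace (X i) else {})"
        using inj by (auto simp: wedge_retraction_inj)
      then show ?thesis by simp
    qed
    assume "None \<in> ?P"
    then have "wedge_summand X x i \<subseteq> ?P" if "i \<noteq> j" for i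
      using that inj by (auto simp: wedge_summand_def wedge_retraction_inj wedge_retraction_None)
    then have "{i. \<not> wedge_summand X x i \<subseteq> ?P} \<subseteq> {j}"
      by blast
    then show "\<forall>\<^sub>\<infinity>i. wedge_summand X x i \<subseteq> ?P"
      unfolding eventually_cofinite by (rule finite_subset) simp
  qed
  then show "openin (shrinking_wedge X x) ?P"
    by (simp add: openin_shrinking_wedge)
qed

lemma continuous_map_wedge_to_product:
  assumes "\<And>j. x j \<in> topspace (X j)"
  shows "continuous_map (shrinking_wedge X x) (product_topology X UNIV) (wedge_to_product x)"
  using continuous_map_wedge_retraction[of x X, OF assms]
  by (simp add: continuous_map_componentwise_UNIV wedge_to_product_def)

lemma wedge_disjoint_generate_retraction:
  fixes X :: "nat \<Rightarrow> 'a topology"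
  assumes base: "\<And>j. x j \<in> topspace (X j)" and n: "n > 0"
  defines "Y \<equiv> shrinking_wedge X x"
  defines "S \<equiv> {whitehead_product n n Y None \<alpha> \<beta> | \<alpha> \<beta>. wedge_disjoint_classes n X x \<alpha> \<beta>}"
  shows "S \<subseteq> carrier (homotopy_group (2 * n - 1) Y None)"
    and "f \<in> loops (2 * n - 1) Y None \<Longrightarrow>
      loop_class (2 * n - 1) Y None f \<in> generate (homotopy_group (2 * n - 1) Y None) S \<Longrightarrow>
      loop_homotopic (2 * n - 1) (X j) (x j) (wedge_retraction x j \<circ> f) (\<lambda>s. x j)"
proof -
  let ?G = "homotopy_group (2 * n - 1) Y None" and ?H = "homotopy_group (2 * n - 1) (X j) (x j)"
  let ?r = "wedge_retraction x j"
  let ?\<rho> = "induced_map (2 * n - 1) (X j) (x j) ?r"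
  have nn: "2 * n - 1 = n + n - 1" by simp
  have r: "continuous_map Y (X j) ?r"
    unfolding Y_def by (rule continuous_map_wedge_retraction[OF base])
  have r_loops: "?r \<circ> f \<in> loops m (X j) (x j)" if "f \<in> loops m Y None" for f m
    using loops_compose[OF that r] by (simp add: wedge_retraction_None)
  have induced: "?\<rho> (loop_class (2 * n - 1) Y None f) = loop_class (2 * n - 1) (X j) (x j) (?r \<circ> f)"
    if "f \<in> loops (2 * n - 1) Y None" for f
    using induced_map_loop_class[OF that r] by (simp add: wedge_retraction_None)
  have "None \<in> topspace Y"
    unfolding Y_def by (rule None_in_shrinking_wedge[OF base])
  then interpret group_hom ?G ?H ?\<rho>
    using group_hom_induced_map[OF _ r, of None "2 * n - 1"] n by (simp add: wedge_retraction_None)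
  have S: "\<exists>h\<in>loops (2 * n - 1) Y None. a = loop_class (2 * n - 1) Y None h \<and>
      loop_homotopic (2 * n - 1) (X j) (x j) (?r \<circ> h) (\<lambda>s. x j)" if a: "a \<in> S" for a
  proof -
    obtain f g where fg: "wedge_disjoint_loops n X x f g"
      and a: "a = whitehead_product n n Y None (loop_class n Y None f) (loop_class n Y None g)"
      using a unfolding S_def wedge_disjoint_classes_def Y_def by blast
    have f: "f \<in> loops n Y None" and g: "g \<in> loops n Y None"
      using fg by (auto simp: wedge_disjoint_loops_def Y_def)
    obtain F G where FG: "F \<inter> G = {}"
      "f ` topspace (unit_cube n) \<subseteq> (\<Union>i\<in>F. wedge_summand X x i)"
      "g ` topspace (unit_cube n) \<subseteq> (\<Union>i\<in>G. wedge_summand X x i)"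
      using fg by (auto simp: wedge_disjoint_loops_def)
    have trivial: "?r w = x j" if "w \<in> (\<Union>i\<in>A. wedge_summand X x i)" "j \<notin> A" for w A
      using that by (auto simp: wedge_summand_def wedge_retraction_inj)
    have "(\<forall>s\<in>topspace (unit_cube n). (?r \<circ> f) s = x j) \<or> (\<forall>s\<in>topspace (unit_cube n). (?r \<circ> g) s = x j)"
    proof (cases "j \<in> F")
      case True
      then have "j \<notin> G" using FG(1) by blast
      then show ?thesis using trivial[of _ G] FG(3) by (auto simp: image_subset_iff)
    next
      case False
      then show ?thesis using trivial[of _ F] FG(2) by (auto simp: image_subset_iff)
    qed
    then have "loop_homotopic (n + n - 1) (X j) (x j) (whitehead_loop n n (?r \<circ> f) (?r \<circ> g)) (\<lambda>s. x j)"
      by (intro whitehead_loop_nullhomotopic[OF n n r_loops[OF f] r_loops[OF g]])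
    then show ?thesis
      using a f g n whitehead_product_loop_class[OF n n f g] whitehead_loop_loops[OF n n f g]
      unfolding nn by (intro bexI[of _ "whitehead_loop n n f g"]) (simp_all add: compose_whitehead_loop)
  qed
  show S_carrier: "S \<subseteq> carrier ?G"
    using S by (auto simp: carrier_homotopy_group)
  have "?\<rho> a = \<one>\<^bsub>?H\<^esub>" if a: "a \<in> S" for a
  proof -
    obtain h where h: "h \<in> loops (2 * n - 1) Y None" "a = loop_class (2 * n - 1) Y None h"
      "loop_homotopic (2 * n - 1) (X j) (x j) (?r \<circ> h) (\<lambda>s. x j)"
      using S[OF a] by blast
    then show ?thesis
      unfolding h(2) induced[OF h(1)] one_homotopy_group using loop_class_eq_iff[OF r_loops] by blast
  qed
  \<comment> \<open>A kernel is a subgroup, so triviality on the Whitehead products extends to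
    everything they generate.\<close>
  then have "S \<subseteq> kernel ?G ?H ?\<rho>"
    using S_carrier by (auto simp: kernel_def)
  then have generate_le: "generate ?G S \<subseteq> kernel ?G ?H ?\<rho>"
    by (rule G.generate_subgroup_incl[OF _ subgroup_kernel])
  show "loop_homotopic (2 * n - 1) (X j) (x j) (?r \<circ> f) (\<lambda>s. x j)"
    if f: "f \<in> loops (2 * n - 1) Y None" and "loop_class (2 * n - 1) Y None f \<in> generate ?G S"
  proof -
    have "?\<rho> (loop_class (2 * n - 1) Y None f) = \<one>\<^bsub>?H\<^esub>"
      using that generate_le unfolding kernel_def by blast
    then show ?thesis
      unfolding induced[OF f] one_homotopy_group using loop_class_eq_iff[OF r_loops[OF f]] by blast
  qed
qed

section \<open>Small loops in CW-complexes\<close>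

definition cube_centre :: "nat \<Rightarrow> nat \<Rightarrow> real"
  where "cube_centre m = (\<lambda>i\<in>{..<m}. 1/2)"

lemma cube_centre_interior: "cube_centre m \<in> topspace (unit_cube m) - cube_boundary m"
  by (auto simp: cube_centre_def topspace_unit_cube cube_boundary_def)

text \<open>The straight-line homotopy from the identity to the radial projection;
  \<open>(1 + u / r) / 2\<close> returns from centred coordinates \<open>u\<close>. At the centre
  the quotient has the default value 0, and continuity is claimed only away from it.\<close>

definition radial_push :: "nat \<Rightarrow> real \<Rightarrow> (nat \<Rightarrow> real) \<Rightarrow> nat \<Rightarrow> real"
  where "radial_push m t s = (\<lambda>i\<in>{..<m}. (1 - t) * s i + t * ((1 + (2 * s i - 1) / cube_radius m s) / 2))"

text \<open>The centre is the only point of radius 0, and in dimension 0 it is the only point at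
  all.\<close>

lemma cube_radius_pos:
  assumes s: "s \<in> topspace (unit_cube m)" and "s \<noteq> cube_centre m"
  shows "m > 0" "cube_radius m s > 0"
proof -
  have "\<exists>i<m. s i \<noteq> 1/2"
  proof (rule ccontr)
    assume "\<not> (\<exists>i<m. s i \<noteq> 1/2)"
    then have "s = cube_centre m"
      using s by (auto simp: cube_centre_def topspace_unit_cube PiE_iff extensional_def fun_eq_iff)
    with assms(2) show False ..
  qed
  then obtain i where "i < m" "s i \<noteq> 1/2" by blast
  then show "m > 0" "cube_radius m s > 0"
    using cube_radius_ge[of i m s] by auto
qed

lemma radial_push_0: "s \<in> topspace (unit_cube m) \<Longrightarrow> radial_push m 0 s = s"
  by (auto simp: radial_push_def topspace_unit_cube PiE_iff extensional_def fun_eq_iff)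

lemma radial_push_boundary:
  assumes "s \<in> cube_boundary m"
  shows "radial_push m t s = s"
proof -
  have "s \<in> topspace (unit_cube m)" using assms cube_boundary_subset by blast
  then show ?thesis
    by (auto simp: radial_push_def cube_radius_boundary[OF assms] topspace_unit_cube PiE_iff
        extensional_def fun_eq_iff algebra_simps)
qed

lemma radial_projection_bounds:
  assumes s: "s \<in> topspace (unit_cube m)" "s \<noteq> cube_centre m" and i: "i < m"
  shows "0 \<le> (1 + (2 * s i - 1) / cube_radius m s) / 2 \<and> (1 + (2 * s i - 1) / cube_radius m s) / 2 \<le> 1"
  using cube_radius_ge[OF i, of s] cube_radius_pos(2)[OF s] by (simp add: field_simps abs_le_iff)

lemma radial_push_mem:
  assumes s: "s \<in> topspace (unit_cube m)" "s \<noteq> cube_centre m" and t: "0 \<le> t" "t \<le> 1"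
  shows "radial_push m t s \<in> topspace (unit_cube m)"
proof -
  have "0 \<le> radial_push m t s i \<and> radial_push m t s i \<le> 1" if "i < m" for i
    using radial_projection_bounds[OF s that] unit_cube_nth[OF s(1) that] t that
      convex_bound_le[of "s i" 1 "(1 + (2 * s i - 1) / cube_radius m s) / 2" "1 - t" t]
    by (auto simp: radial_push_def intro!: add_nonneg_nonneg mult_nonneg_nonneg)
  then show ?thesis
    by (auto simp: topspace_unit_cube radial_push_def)
qed

lemma radial_push_1:
  assumes s: "s \<in> topspace (unit_cube m)" "s \<noteq> cube_centre m"
  shows "radial_push m 1 s \<in> cube_boundary m"
proof -
  obtain i where i: "i < m" "cube_radius m s = \<bar>2 * s i - 1\<bar>"
    using cube_radius_attained[OF cube_radius_pos(1)[OF s]] by blast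
  then have "(2 * s i - 1) / cube_radius m s = 1 \<or> (2 * s i - 1) / cube_radius m s = - 1"
    using cube_radius_pos(2)[OF s] by (cases "2 * s i - 1 \<ge> 0") (auto simp: field_simps)
  then have "radial_push m 1 s i = 0 \<or> radial_push m 1 s i = 1"
    using i(1) by (auto simp: radial_push_def)
  then show ?thesis
    using i(1) radial_push_mem[OF s, of 1] by (auto simp: cube_boundary_def)
qed

lemma continuous_map_radial_push:
  "continuous_map (prod_topology unit_interval (subtopology (unit_cube m) (- {cube_centre m}))) (unit_cube m)
    (\<lambda>z. radial_push m (fst z) (snd z))"
proof (rule continuous_map_unit_cubeI)
  let ?C = "subtopology (unit_cube m) (- {cube_centre m})"
  let ?Z = "prod_topology unit_interval ?C"
  have t: "continuous_map ?Z euclideanreal fst"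
    by (metis continuous_map_fst continuous_map_into_fulltopology)
  have s: "continuous_map ?Z (unit_cube m) snd"
    by (metis continuous_map_snd continuous_map_into_fulltopology)
  have r: "continuous_map ?Z euclideanreal (\<lambda>z. cube_radius m (snd z))"
    using continuous_map_compose[OF s continuous_map_cube_radius] unfolding o_def .
  have pos: "cube_radius m (snd z) \<noteq> 0" if "z \<in> topspace ?Z" for z
    using that cube_radius_pos(2)[of "snd z" m] by auto
  show "continuous_map ?Z euclideanreal (\<lambda>z. radial_push m (fst z) (snd z) i)" if "i < m" for i
    using that continuous_map_unit_cube_nth[OF s that]
    by (simp add: radial_push_def) (intro continuous_intros t r pos; simp)
  show "0 \<le> radial_push m (fst z) (snd z) i \<and> radial_push m (fst z) (snd z) i \<le> 1"
    if "z \<in> topspace ?Z" "i < m" for z i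
    by (rule unit_cube_nth[OF radial_push_mem]) (use that in auto)
qed (simp add: radial_push_def)

section \<open>Finite subcomplexes and compact sets\<close>

locale cw_structure =
  fixes X :: "'a topology" and E :: "'a set set" and d :: "'a set \<Rightarrow> nat"
    and \<Phi> :: "'a set \<Rightarrow> (nat \<Rightarrow> real) \<Rightarrow> 'a"
  assumes cw: "CW_structure X E d \<Phi>"
begin

lemma Hausdorff: "Hausdorff_space X"
  using cw by (simp add: CW_structure_def)

lemma cells_disjoint: "e \<in> E \<Longrightarrow> e' \<in> E \<Longrightarrow> e \<noteq> e' \<Longrightarrow> e \<inter> e' = {}"
  using cw by (auto simp: CW_structure_def disjoint_def)

lemma cells_cover: "\<Union>E = topspace X"
  using cw by (simp add: CW_structure_def)

lemma continuous_map_cell: "e \<in> E \<Longrightarrow> continuous_map (unit_cube (d e)) X (\<Phi> e)"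
  using cw by (simp add: CW_structure_def)

lemma homeomorphic_map_cell:
  "e \<in> E \<Longrightarrow> homeomorphic_map
    (subtopology (unit_cube (d e)) (topspace (unit_cube (d e)) - cube_boundary (d e))) (subtopology X e) (\<Phi> e)"
  using cw by (simp add: CW_structure_def)

lemma cell_boundary:
  assumes "e \<in> E"
  obtains F where "finite F" "F \<subseteq> {e'\<in>E. d e' < d e}" "\<Phi> e ` cube_boundary (d e) \<subseteq> \<Union>F"
  using assms cw unfolding CW_structure_def by blast

lemma weak_topology:
  "A \<subseteq> topspace X \<Longrightarrow> (\<And>e. e \<in> E \<Longrightarrow> closedin X (A \<inter> X closure_of e)) \<Longrightarrow> closedin X A"
  using cw unfolding CW_structure_def by blast

lemma cell_interior_image:
  assumes "e \<in> E"
  shows "\<Phi> e ` (topspace (unit_cube (d e)) - cube_boundary (d e)) = e"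
proof -
  have "topspace X \<inter> e = e" using assms cells_cover by blast
  then show ?thesis
    using homeomorphic_imp_surjective_map[OF homeomorphic_map_cell[OF assms]] by (simp add: Int_absorb1)
qed

lemma cell_inj_on: "e \<in> E \<Longrightarrow> inj_on (\<Phi> e) (topspace (unit_cube (d e)) - cube_boundary (d e))"
  using homeomorphic_imp_injective_map[OF homeomorphic_map_cell[of e]] by (simp add: Int_absorb1)

text \<open>An explicit set that contains the closure of \<open>e\<close>: as the image of a compact
  space in a Hausdorff space it is closed.\<close>

definition closed_cell :: "'a set \<Rightarrow> 'a set"
  where "closed_cell e = \<Phi> e ` topspace (unit_cube (d e))"

lemma closed_cell_eq: "e \<in> E \<Longrightarrow> closed_cell e = e \<union> \<Phi> e ` cube_boundary (d e)"
  unfolding closed_cell_def using cell_interior_image[of e] cube_boundary_subset[of "d e"] by blast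

lemma closedin_closed_cell: "e \<in> E \<Longrightarrow> closedin X (closed_cell e)"
  using compactin_imp_closedin[OF Hausdorff] image_compactin[OF _ continuous_map_cell]
    compact_space_unit_cube[of "d e"]
  by (simp add: closed_cell_def compact_space_def)

lemma closure_of_cell: "e \<in> E \<Longrightarrow> X closure_of e \<subseteq> closed_cell e"
  using closedin_closed_cell closed_cell_eq by (intro closure_of_minimal) auto

text \<open>These are the finite subcomplexes, presented by their cells. Keeping track of dimensions
  ensures that a cell of top dimension can be removed.\<close>

definition cell_closed :: "'a set set \<Rightarrow> bool"
  where "cell_closed C \<longleftrightarrow> finite C \<and> C \<subseteq> E \<and>
    (\<forall>e\<in>C. \<Phi> e ` cube_boundary (d e) \<subseteq> \<Union>{e'\<in>C. d e' < d e})"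

lemma cell_closed_Union:
  assumes "finite I" "\<And>i. i \<in> I \<Longrightarrow> cell_closed (C i)"
  shows "cell_closed (\<Union>i\<in>I. C i)"
  using assms unfolding cell_closed_def by (auto, blast)

text \<open>The boundary of each member is covered by other members, so the union of the open cells
  is also a finite union of closed ones.\<close>

lemma closedin_cell_closed:
  assumes "cell_closed C"
  shows "closedin X (\<Union>C)"
proof -
  have "e \<subseteq> closed_cell e" "closed_cell e \<subseteq> \<Union>C" if e: "e \<in> C" for e
  proof -
    have "e \<in> E" "\<Phi> e ` cube_boundary (d e) \<subseteq> \<Union>{e'\<in>C. d e' < d e}"
      using assms e unfolding cell_closed_def by auto
    then show "e \<subseteq> closed_cell e" "closed_cell e \<subseteq> \<Union>C"
      using e closed_cell_eq[of e] by auto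
  qed
  then have "\<Union>C = (\<Union>e\<in>C. closed_cell e)"
    by (intro equalityI UN_least) auto
  moreover have "closedin X (\<Union>e\<in>C. closed_cell e)"
    using assms closedin_closed_cell unfolding cell_closed_def by (intro closedin_Union) auto
  ultimately show ?thesis by simp
qed

text \<open>Closure finiteness provides finitely many cells of lower dimension around the boundary;
  by induction each of them has its own finite subcomplex.\<close>

lemma cell_closed_exists: "e \<in> E \<Longrightarrow> \<exists>C. cell_closed C \<and> e \<in> C"
proof (induction "d e" arbitrary: e rule: less_induct)
  case less
  obtain F where F: "finite F" "F \<subseteq> {e'\<in>E. d e' < d e}" "\<Phi> e ` cube_boundary (d e) \<subseteq> \<Union>F"
    using cell_boundary[OF less.prems] .
  have "\<forall>e'\<in>F. \<exists>C. cell_closed C \<and> e' \<in> C"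
    using less.hyps F(2) by blast
  then obtain C where C: "\<And>e'. e' \<in> F \<Longrightarrow> cell_closed (C e') \<and> e' \<in> C e'"
    by metis
  have U: "cell_closed (\<Union>e'\<in>F. C e')"
    using F(1) C by (intro cell_closed_Union) auto
  have "F \<subseteq> {e'. e' \<in> insert e (\<Union>e'\<in>F. C e') \<and> d e' < d e}"
    using F(2) C by auto
  with F(3) have "\<Phi> e ` cube_boundary (d e) \<subseteq> \<Union>{e'. e' \<in> insert e (\<Union>e'\<in>F. C e') \<and> d e' < d e}"
    by blast
  moreover have "\<Phi> e0 ` cube_boundary (d e0) \<subseteq> \<Union>{e'. e' \<in> insert e (\<Union>e'\<in>F. C e') \<and> d e' < d e0}"
    if "e0 \<in> (\<Union>e'\<in>F. C e')" for e0
    using U that unfolding cell_closed_def by blast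
  ultimately have "cell_closed (insert e (\<Union>e'\<in>F. C e'))"
    using U less.prems unfolding cell_closed_def by simp
  then show ?case by blast
qed

text \<open>One point from each cell meeting a compact set forms a closed discrete subset of that compact set.\<close>

lemma compactin_finite_cells:
  assumes K: "compactin X K"
  shows "finite {e\<in>E. e \<inter> K \<noteq> {}}"
proof -
  let ?F = "{e\<in>E. e \<inter> K \<noteq> {}}"
  define pt where "pt e = (SOME y. y \<in> e \<inter> K)" for e
  have pt: "pt e \<in> e \<inter> K" if e: "e \<in> ?F" for e
  proof -
    obtain y where "y \<in> e \<inter> K" using e by auto
    then show ?thesis unfolding pt_def by (rule someI)
  qed
  have inj: "inj_on pt ?F"
  proof (rule inj_onI)
    fix e e' assume e: "e \<in> ?F" "e' \<in> ?F" "pt e = pt e'"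
    then have "e \<inter> e' \<noteq> {}" using pt[of e] pt[of e'] by auto
    with e show "e = e'" using cells_disjoint[of e e'] by auto
  qed
  let ?T = "pt ` ?F"
  have KX: "K \<subseteq> topspace X" using K compactin_subset_topspace by blast
  have TX: "?T \<subseteq> topspace X" using pt KX by auto
  \<comment> \<open>A closed cell is covered by \<open>e\<close> and finitely many other cells, so
    it contains only finitely many of the chosen points; finite sets are closed in a Hausdorff
    space.\<close>
  have closed: "closedin X A" if A: "A \<subseteq> ?T" for A
  proof (rule weak_topology)
    show "A \<subseteq> topspace X" using A TX by simp
    fix e assume e: "e \<in> E"
    obtain F where F: "finite F" "F \<subseteq> {e'\<in>E. d e' < d e}" "\<Phi> e ` cube_boundary (d e) \<subseteq> \<Union>F"
      using cell_boundary[OF e] .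
    have "A \<inter> X closure_of e \<subseteq> pt ` insert e F"
    proof
      fix a assume a: "a \<in> A \<inter> X closure_of e"
      then obtain e' where e': "e' \<in> ?F" "a = pt e'" using A by blast
      have "a \<in> e \<union> \<Phi> e ` cube_boundary (d e)"
        using a closure_of_cell[OF e] closed_cell_eq[OF e] by auto
      then have "a \<in> \<Union>(insert e F)"
        using F(3) by auto
      then obtain e'' where e'': "e'' \<in> insert e F" "a \<in> e''"
        by auto
      have "e'' \<in> E" using e'' F(2) e by blast
      then have "e'' = e'"
        using cells_disjoint[of e'' e'] e' e'' pt[OF e'(1)] by blast
      with e' e'' show "a \<in> pt ` insert e F" by blast
    qed
    then have "finite (A \<inter> X closure_of e)"
      by (rule finite_subset) (use F(1) in simp)
    moreover have "A \<inter> X closure_of e \<subseteq> topspace X"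
      using closure_of_subset_topspace[of X e] by auto
    ultimately show "closedin X (A \<inter> X closure_of e)"
      using Hausdorff_imp_t1_space[OF Hausdorff] unfolding t1_space_closedin_finite by auto
  qed
  have "compactin X ?T"
    using K by (rule closed_compactin[OF _ _ closed]) (use pt in auto)
  \<comment> \<open>Since all subsets of \<open>?T\<close> are closed, the subspace is discrete;
    being compact as well, it is finite.\<close>
  moreover have "subtopology X ?T = discrete_topology ?T"
  proof (rule discrete_topology_unique[THEN iffD2, symmetric], intro conjI ballI)
    show "topspace (subtopology X ?T) = ?T" using pt KX by auto
    fix a assume a: "a \<in> ?T"
    have "closedin X (?T - {a})" by (rule closed) auto
    then have "closedin (subtopology X ?T) (?T - {a})"
      by (rule closedin_subset_topspace) auto
    moreover have "topspace (subtopology X ?T) = ?T" using pt KX by auto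
    ultimately show "openin (subtopology X ?T) {a}"
      using a openin_diff[OF openin_topspace, of "subtopology X ?T" "?T - {a}"] by (simp add: Diff_Diff_Int)
  qed
  ultimately have "finite ?T"
    by (simp add: compactin_subspace compact_space_discrete_topology)
  then show ?thesis
    using inj finite_image_iff by blast
qed

lemma compactin_cell_closed:
  assumes K: "compactin X K"
  obtains C where "cell_closed C" "K \<subseteq> \<Union>C"
proof -
  let ?F = "{e\<in>E. e \<inter> K \<noteq> {}}"
  have "\<forall>e\<in>?F. \<exists>C. cell_closed C \<and> e \<in> C"
    using cell_closed_exists by simp
  from bchoice[OF this] obtain C where C: "\<And>e. e \<in> ?F \<Longrightarrow> cell_closed (C e) \<and> e \<in> C e"
    by blast
  have "cell_closed (\<Union>e\<in>?F. C e)"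
    using C compactin_finite_cells[OF K] by (intro cell_closed_Union) auto
  moreover have "K \<subseteq> \<Union>(\<Union>e\<in>?F. C e)"
  proof
    fix y assume y: "y \<in> K"
    then obtain e where "e \<in> E" "y \<in> e"
      using cells_cover compactin_subset_topspace[OF K] by blast
    moreover from this have "e \<in> C e" using y C[of e] by blast
    ultimately show "y \<in> \<Union>(\<Union>e\<in>?F. C e)" using y by auto
  qed
  ultimately show ?thesis by (rule that)
qed

section \<open>Contracting and pushing loops in cells\<close>

text \<open>In the coordinates of the cell the loop is moved to the basepoint along straight lines.
  These stay in the closed cube by convexity, and \<Phi> is continuous on all of it, so the result
  is a null-homotopy in the whole space.\<close>

lemma loop_in_cell_nullhomotopic:
  assumes e: "e \<in> E" and x: "x \<in> e" and f: "f \<in> loops m X x" and im: "f ` topspace (unit_cube m) \<subseteq> e"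
  shows "loop_homotopic m X x f (\<lambda>s. x)"
proof -
  let ?I = "topspace (unit_cube (d e)) - cube_boundary (d e)"
  obtain \<psi> where \<psi>: "homeomorphic_maps (subtopology (unit_cube (d e)) ?I) (subtopology X e) (\<Phi> e) \<psi>"
    using homeomorphic_map_cell[OF e] homeomorphic_map_maps by blast
  have eX: "e \<subseteq> topspace X" using e cells_cover by blast
  have \<psi>_cont: "continuous_map (subtopology X e) (unit_cube (d e)) \<psi>"
    using \<psi> by (auto simp: homeomorphic_maps_def continuous_map_in_subtopology)
  have \<psi>_mem: "\<psi> y \<in> topspace (unit_cube (d e))" if "y \<in> e" for y
    using continuous_map_image_subset_topspace[OF \<psi>_cont] that eX by auto
  have \<Phi>\<psi>: "\<Phi> e (\<psi> y) = y" if "y \<in> e" for y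
    using \<psi> that eX by (auto simp: homeomorphic_maps_def)
  let ?Z = "prod_topology unit_interval (unit_cube m)"
  let ?l = "\<lambda>z. \<lambda>i\<in>{..<d e}. (1 - fst z) * \<psi> (f (snd z)) i + fst z * \<psi> x i"
  have restr: "restrict (\<psi> y) {..<d e} = \<psi> y" if "y \<in> e" for y
    using \<psi>_mem[OF that] by (simp add: topspace_unit_cube)
  have "continuous_map (unit_cube m) (subtopology X e) f"
    using loops_continuous[OF f] im by (auto simp: continuous_map_in_subtopology)
  then have "continuous_map (unit_cube m) (unit_cube (d e)) (\<psi> \<circ> f)"
    using \<psi>_cont continuous_map_compose by blast
  from continuous_map_compose[OF continuous_map_snd this]
  have "continuous_map ?Z (unit_cube (d e)) (\<lambda>z. \<psi> (f (snd z)))"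
    by (simp add: o_def)
  then have coord: "continuous_map ?Z euclideanreal (\<lambda>z. \<psi> (f (snd z)) i)" if "i < d e" for i
    using continuous_map_unit_cube_nth that by blast
  have t: "continuous_map ?Z euclideanreal fst"
    by (metis continuous_map_fst continuous_map_into_fulltopology)
  have "continuous_map ?Z (unit_cube (d e)) ?l"
  proof (rule continuous_map_unit_cubeI)
    show "continuous_map ?Z euclideanreal (\<lambda>z. ?l z i)" if "i < d e" for i
      using that by simp (intro continuous_intros t coord; simp)
    show "0 \<le> ?l z i \<and> ?l z i \<le> 1" if "z \<in> topspace ?Z" "i < d e" for z i
    proof -
      have "0 \<le> \<psi> (f (snd z)) i \<and> \<psi> (f (snd z)) i \<le> 1" "0 \<le> \<psi> x i \<and> \<psi> x i \<le> 1"
        using that im x by (auto intro!: unit_cube_nth \<psi>_mem)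
      then show ?thesis
        using that convex_bound_le[of "\<psi> (f (snd z)) i" 1 "\<psi> x i" "1 - fst z" "fst z"]
        by (auto intro!: add_nonneg_nonneg mult_nonneg_nonneg)
    qed
  qed simp
  then have "continuous_map ?Z X (\<Phi> e \<circ> ?l)"
    using continuous_map_cell[OF e] continuous_map_compose by blast
  then show ?thesis
  proof (rule loop_homotopicI)
    fix s assume "s \<in> topspace (unit_cube m)"
    then have "f s \<in> e" using im by blast
    then show "(\<Phi> e \<circ> ?l) (0, s) = f s"
      by (simp add: restr \<Phi>\<psi>)
    show "(\<Phi> e \<circ> ?l) (1, s) = x"
      using x by (simp add: restr \<Phi>\<psi>)
  next
    fix t s assume "s \<in> cube_boundary m"
    then have "(\<lambda>i\<in>{..<d e}. (1 - t) * \<psi> (f s) i + t * \<psi> x i) = \<psi> x"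
      using loops_boundary[OF f] restr[OF x] by (simp add: algebra_simps)
    then show "(\<Phi> e \<circ> ?l) (t, s) = x"
      using x by (simp add: \<Phi>\<psi>)
  qed
qed

text \<open>
  Pushing radially away from the centre of the cell \<open>e\<close> retracts the complement of that centre in
  \<open>B \<union> e\<close> onto \<open>B\<close>. Continuity is tested on the closed sets \<open>B\<close> and the closed cell; the latter is
  a quotient of the cube, even after taking the product with the interval, by compactness.
\<close>

lemma cell_push:
  assumes e: "e \<in> E" and B: "closedin X B" "B \<inter> e = {}" "\<Phi> e ` cube_boundary (d e) \<subseteq> B"
  defines "V \<equiv> B \<union> e - {\<Phi> e (cube_centre (d e))}"
  obtains D where "continuous_map (prod_topology unit_interval (subtopology X V)) X D"
    and "\<And>y. y \<in> V \<Longrightarrow> D (0, y) = y" "\<And>y. y \<in> V \<Longrightarrow> D (1, y) \<in> B"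
    and "\<And>t y. y \<in> B \<Longrightarrow> D (t, y) = y"
proof -
  let ?Q = "unit_cube (d e)" and ?c = "cube_centre (d e)"
  let ?I = "topspace ?Q - cube_boundary (d e)"
  let ?p = "\<Phi> e ?c"
  define \<psi> where "\<psi> = inv_into ?I (\<Phi> e)"
  define D where "D = (\<lambda>(t, y). if y \<in> B then y else \<Phi> e (radial_push (d e) t (\<psi> y)))"
  have p: "?p \<in> e"
    using cell_interior_image[OF e] cube_centre_interior[of "d e"] by blast
  have eX: "e \<subseteq> topspace X" using e cells_cover by blast
  have BX: "B \<subseteq> topspace X" using B(1) closedin_subset by blast
  have \<psi>: "\<psi> y \<in> ?I" "\<Phi> e (\<psi> y) = y" if "y \<in> e" for y
  proof -
    have "y \<in> \<Phi> e ` ?I" using that cell_interior_image[OF e] by simp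
    then show "\<psi> y \<in> ?I" "\<Phi> e (\<psi> y) = y"
      unfolding \<psi>_def by (rule inv_into_into, rule f_inv_into_f)
  qed
  have \<psi>_\<Phi>: "\<psi> (\<Phi> e s) = s" if "s \<in> ?I" for s
    unfolding \<psi>_def by (rule inv_into_f_f[OF cell_inj_on[OF e] that])
  \<comment> \<open>Boundary points go to \<open>B\<close>, which misses \<open>e\<close>, and
    \<Phi> is injective inside; hence deleting the centre of the cell deletes only one point of the
    cube.\<close>
  have centre: "\<Phi> e s = ?p \<longleftrightarrow> s = ?c" if s: "s \<in> topspace ?Q" for s
  proof
    assume eq: "\<Phi> e s = ?p"
    have "s \<notin> cube_boundary (d e)"
    proof
      assume "s \<in> cube_boundary (d e)"
      then have "\<Phi> e s \<in> B" using B(3) by auto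
      with eq p B(2) show False by auto
    qed
    with s have "s \<in> ?I" by simp
    then show "s = ?c"
      using eq cell_inj_on[OF e] cube_centre_interior[of "d e"] by (auto dest: inj_onD)
  qed simp
  have \<psi>_centre: "\<psi> y \<noteq> ?c" if "y \<in> V" "y \<in> e" for y
    using that \<psi>(2)[of y] by (auto simp: V_def)
  have D_B: "D (t, y) = y" if "y \<in> B" for t y
    using that by (simp add: D_def)
  \<comment> \<open>The push fixes the boundary of the cube, as \<open>D\<close> fixes
    \<open>B\<close>, so one formula describes \<open>D\<close> on the whole closed cell.\<close>
  have D_\<Phi>: "D (t, \<Phi> e s) = \<Phi> e (radial_push (d e) t s)" if "s \<in> topspace ?Q" for t s
  proof (cases "s \<in> cube_boundary (d e)")
    case True
    then show ?thesis using B(3) by (simp add: D_B radial_push_boundary image_subset_iff)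
  next
    case False
    then have "s \<in> ?I" using that by blast
    then have "\<Phi> e s \<in> e" using cell_interior_image[OF e] by blast
    then have "\<Phi> e s \<notin> B" using B(2) by blast
    then show ?thesis using \<psi>_\<Phi>[OF \<open>s \<in> ?I\<close>] by (simp add: D_def)
  qed
  let ?V = "subtopology X V"
  let ?Z = "prod_topology unit_interval ?V"
  let ?K = "closed_cell e"
  have K: "closedin X ?K" "?K = e \<union> \<Phi> e ` cube_boundary (d e)" "?K \<subseteq> topspace X"
    using closedin_closed_cell[OF e] closed_cell_eq[OF e] closedin_subset by blast+
  have VK: "V \<inter> ?K = ?K - {?p}"
    using K(2) B(3) by (auto simp: V_def)
  let ?q = "\<lambda>z. (fst z, \<Phi> e (snd z))"
  have q: "quotient_map (prod_topology unit_interval ?Q) (prod_topology unit_interval (subtopology X ?K)) ?q"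
  proof (rule continuous_imp_quotient_map)
    have "continuous_map ?Q (subtopology X ?K) (\<Phi> e)"
      using continuous_map_cell[OF e] by (auto simp: continuous_map_in_subtopology closed_cell_def)
    then show "continuous_map (prod_topology unit_interval ?Q) (prod_topology unit_interval (subtopology X ?K)) ?q"
      using continuous_map_compose[OF continuous_map_snd] unfolding o_def
      by (intro continuous_map_pairedI continuous_map_fst) blast
    show "compact_space (prod_topology unit_interval ?Q)"
      by (simp add: compact_space_prod_topology compact_space_unit_cube compact_space_subtopology)
    show "Hausdorff_space (prod_topology unit_interval (subtopology X ?K))"
      by (simp add: Hausdorff_space_prod_topology Hausdorff_space_subtopology Hausdorff)
    show "?q ` topspace (prod_topology unit_interval ?Q) = topspace (prod_topology unit_interval (subtopology X ?K))"
      using K(3) by (auto simp: closed_cell_def image_iff)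
  qed
  \<comment> \<open>The closed cell without the centre is open in the closed cell and its preimage
    is the punctured cube, so the quotient property restricts to it.\<close>
  have qr: "quotient_map (prod_topology unit_interval (subtopology ?Q (- {?c})))
      (prod_topology unit_interval (subtopology X (V \<inter> ?K))) ?q"
  proof -
    let ?W = "{0..1::real} \<times> (?K - {?p})"
    have "openin (subtopology X ?K) (?K - {?p})"
    proof -
      have "closedin X {?p}"
        using p eX by (intro closedin_Hausdorff_singleton Hausdorff) auto
      then have "openin X (topspace X - {?p})" by blast
      moreover have "?K - {?p} = (topspace X - {?p}) \<inter> ?K" using K(3) by blast
      ultimately show ?thesis unfolding openin_subtopology by blast
    qed
    then have "openin (prod_topology unit_interval (subtopology X ?K)) ?W"
      by (simp add: openin_prod_Times_iff)
    then have "quotient_map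
        (subtopology (prod_topology unit_interval ?Q) {z \<in> topspace (prod_topology unit_interval ?Q). ?q z \<in> ?W})
        (subtopology (prod_topology unit_interval (subtopology X ?K)) ?W) ?q"
      by (intro quotient_map_restriction[OF q refl]) blast
    moreover have "{z \<in> topspace (prod_topology unit_interval ?Q). ?q z \<in> ?W} = {0..1} \<times> (topspace ?Q \<inter> - {?c})"
      using centre by (auto simp: closed_cell_def)
    moreover have "subtopology (prod_topology unit_interval ?Q) ({0..1} \<times> (topspace ?Q \<inter> - {?c})) =
        prod_topology unit_interval (subtopology ?Q (- {?c}))"
      unfolding subtopology_Times subtopology_restrict subtopology_subtopology by simp
    moreover have "subtopology (prod_topology unit_interval (subtopology X ?K)) ?W =
        prod_topology unit_interval (subtopology X (V \<inter> ?K))"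
      unfolding subtopology_Times subtopology_subtopology VK by (simp add: Int_absorb1)
    ultimately show ?thesis
      by (simp only:)
  qed
  have D_K: "continuous_map (prod_topology unit_interval (subtopology X (V \<inter> ?K))) X D"
  proof (rule continuous_compose_quotient_map[OF qr])
    have "continuous_map (prod_topology unit_interval (subtopology ?Q (- {?c}))) X
        (\<lambda>z. \<Phi> e (radial_push (d e) (fst z) (snd z)))"
      using continuous_map_compose[OF continuous_map_radial_push continuous_map_cell[OF e]] unfolding o_def .
    then show "continuous_map (prod_topology unit_interval (subtopology ?Q (- {?c}))) X (D \<circ> ?q)"
      by (rule continuous_map_eq) (auto simp: D_\<Phi>)
  qed
  have "continuous_map ?Z X D"
  proof (rule pasting_lemma_closed[where I=UNIV
        and T="\<lambda>b. if b then {z \<in> topspace ?Z. snd z \<in> V \<inter> B} else {z \<in> topspace ?Z. snd z \<in> V \<inter> ?K}"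
        and f="\<lambda>b. if b then snd else D"])
    show "closedin ?Z (if b then {z \<in> topspace ?Z. snd z \<in> V \<inter> B} else {z \<in> topspace ?Z. snd z \<in> V \<inter> ?K})" for b
    proof -
      have "closedin ?V (V \<inter> B)" "closedin ?V (V \<inter> ?K)"
        using B(1) K(1) by (auto simp: closedin_subtopology)
      from this[THEN closedin_continuous_map_preimage[OF continuous_map_snd[of unit_interval ?V]]]
      show ?thesis by (cases b) (simp_all only: if_True if_False)
    qed
    have "subtopology ?Z {z \<in> topspace ?Z. snd z \<in> V \<inter> ?K} =
        prod_topology unit_interval (subtopology X (V \<inter> ?K))"
    proof -
      have "{z \<in> topspace ?Z. snd z \<in> V \<inter> ?K} = {0..1} \<times> (V \<inter> ?K)"
        using K(3) by auto
      then show ?thesis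
        by (simp add: subtopology_Times subtopology_subtopology Int_absorb1)
    qed
    moreover have "continuous_map ?Z X snd"
      by (metis continuous_map_snd continuous_map_into_fulltopology)
    ultimately show "continuous_map
        (subtopology ?Z (if b then {z \<in> topspace ?Z. snd z \<in> V \<inter> B} else {z \<in> topspace ?Z. snd z \<in> V \<inter> ?K})) X
        (if b then snd else D)" for b
      using D_K by (simp add: continuous_map_from_subtopology)
    show "\<exists>b. b \<in> UNIV \<and>
        z \<in> (if b then {z \<in> topspace ?Z. snd z \<in> V \<inter> B} else {z \<in> topspace ?Z. snd z \<in> V \<inter> ?K}) \<and>
        D z = (if b then snd else D) z" if "z \<in> topspace ?Z" for z
    proof (cases "snd z \<in> B")
      case True
      then have "D z = snd z" using D_B[of "snd z" "fst z"] by simp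
      then show ?thesis using True that by (intro exI[of _ True]) auto
    next
      case False
      then have "snd z \<in> ?K" using that K(2) by (auto simp: V_def)
      then show ?thesis using that by (intro exI[of _ False]) auto
    qed
  qed (auto simp: D_B split: if_splits)
  moreover have "D (0, y) = y" if "y \<in> V" for y
  proof (cases "y \<in> B")
    case False
    then have "y \<in> e" using that by (auto simp: V_def)
    then show ?thesis using False \<psi>[of y] by (simp add: D_def radial_push_0)
  qed (simp add: D_B)
  moreover have "D (1, y) \<in> B" if "y \<in> V" for y
  proof (cases "y \<in> B")
    case False
    then have y: "y \<in> e" using that by (auto simp: V_def)
    then have "radial_push (d e) 1 (\<psi> y) \<in> cube_boundary (d e)"
      using \<psi>(1)[OF y] \<psi>_centre[OF that y] by (intro radial_push_1) auto
    then show ?thesis using False B(3) by (auto simp: D_def)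
  qed (simp add: D_B)
  ultimately show ?thesis using that D_B by blast
qed

text \<open>Only the loop is small; its contraction may use all of \<open>X\<close>. This weak form
  survives the induction, since a neighbourhood in the smaller subcomplex can be pulled back along a
  retraction.\<close>

lemma finite_subcomplex_small_loops:
  assumes "cell_closed C" "x \<in> \<Union>C"
  shows "\<exists>U. openin (subtopology X (\<Union>C)) U \<and> x \<in> U \<and>
    (\<forall>f\<in>loops m X x. f ` topspace (unit_cube m) \<subseteq> U \<longrightarrow> loop_homotopic m X x f (\<lambda>s. x))"
  using assms
proof (induction "card C" arbitrary: C rule: less_induct)
  case less
  note C = less.prems(1)
  have fin: "finite C" and CE: "C \<subseteq> E"
    using C by (auto simp: cell_closed_def)
  have "C \<noteq> {}" using less.prems(2) by blast
  then have "Max (d ` C) \<in> d ` C" using fin by (intro Max_in) auto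
  then obtain e where e: "e \<in> C" "d e = Max (d ` C)" by auto
  then have max: "d e' \<le> d e" if "e' \<in> C" for e'
    using that fin by simp
  have eE: "e \<in> E" using e(1) CE by blast
  define C' where "C' = C - {e}"
  let ?B = "\<Union>C'"
  have C_eq: "C = insert e C'" using e(1) by (auto simp: C'_def)
  \<comment> \<open>A cell of top dimension never helps to cover the boundary of another cell, so
    the remaining cells form a subcomplex.\<close>
  have "{e'' \<in> C. d e'' < d e'} \<subseteq> {e'' \<in> C'. d e'' < d e'}" if "e' \<in> C" for e'
    using max[OF that] by (auto simp: C'_def)
  then have bd: "\<Phi> e' ` cube_boundary (d e') \<subseteq> \<Union>{e'' \<in> C'. d e'' < d e'}" if "e' \<in> C" for e'
    using C that unfolding cell_closed_def by blast
  then have C': "cell_closed C'"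
    using fin CE unfolding cell_closed_def by (auto simp: C'_def)
  have disj: "?B \<inter> e = {}"
    using cells_disjoint eE CE unfolding C'_def by blast
  have eX: "e \<subseteq> topspace X" using eE cells_cover by blast
  have closedB: "closedin X ?B" by (rule closedin_cell_closed[OF C'])
  show ?case
  proof (cases "x \<in> e")
    case True
    \<comment> \<open>Removing the closed set of all other cells shows that a top cell is open in
      the subcomplex, so it can serve as the neighbourhood itself.\<close>
    have "e = (topspace X - ?B) \<inter> \<Union>C"
      using disj eX unfolding C_eq by blast
    then have "openin (subtopology X (\<Union>C)) e"
      using closedB unfolding openin_subtopology by blast
    then show ?thesis
      using True loop_in_cell_nullhomotopic[OF eE True] by blast
  next
    case False
    then have x: "x \<in> ?B" using less.prems(2) unfolding C_eq by blast
    have "card C' < card C"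
      using fin e(1) unfolding C'_def by (intro psubset_card_mono) auto
    from less.hyps[OF this C' x]
    obtain U where "openin (subtopology X ?B) U \<and> x \<in> U \<and>
      (\<forall>f\<in>loops m X x. f ` topspace (unit_cube m) \<subseteq> U \<longrightarrow> loop_homotopic m X x f (\<lambda>s. x))"
      by (elim exE)
    then have U: "openin (subtopology X ?B) U" "x \<in> U"
      "\<And>f. f \<in> loops m X x \<Longrightarrow> f ` topspace (unit_cube m) \<subseteq> U \<Longrightarrow> loop_homotopic m X x f (\<lambda>s. x)"
      by simp_all
    let ?p = "\<Phi> e (cube_centre (d e))"
    let ?V = "?B \<union> e - {?p}"
    have p: "?p \<in> e"
      using cell_interior_image[OF eE] cube_centre_interior[of "d e"] by blast
    have bdB: "\<Phi> e ` cube_boundary (d e) \<subseteq> ?B"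
      using bd[OF e(1)] by blast
    obtain D where D: "continuous_map (prod_topology unit_interval (subtopology X ?V)) X D"
      "\<And>y. y \<in> ?V \<Longrightarrow> D (0, y) = y" "\<And>y. y \<in> ?V \<Longrightarrow> D (1, y) \<in> ?B"
      "\<And>t y. y \<in> ?B \<Longrightarrow> D (t, y) = y"
      by (rule cell_push[OF eE closedB disj bdB]) blast
    have VX: "?V \<subseteq> topspace X"
      using eX closedin_subset[OF closedB] by blast
    have r: "continuous_map (subtopology X ?V) (subtopology X ?B) (\<lambda>y. D (1, y))"
      using continuous_map_pair_arg[OF D(1), of "subtopology X ?V" "\<lambda>y. 1" "\<lambda>y. y"] D(3)
      by (auto simp: continuous_map_in_subtopology)
    \<comment> \<open>The neighbourhood consists of the points that the push retracts into
      \<open>U\<close>; it avoids the centre of \<open>e\<close>, so the push can be applied to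
      loops in it.\<close>
    define W where "W = {y \<in> topspace (subtopology X ?V). D (1, y) \<in> U}"
    have W: "openin (subtopology X ?V) W"
      unfolding W_def by (rule openin_continuous_map_preimage[OF r U(1)])
    have "closedin X {?p}"
      using p eX by (intro closedin_Hausdorff_singleton Hausdorff) auto
    moreover have "?V = (topspace X - {?p}) \<inter> \<Union>C"
      using VX unfolding C_eq by blast
    ultimately have "openin (subtopology X (\<Union>C)) ?V"
      unfolding openin_subtopology by blast
    moreover have "subtopology X ?V = subtopology (subtopology X (\<Union>C)) ?V"
      unfolding C_eq by (simp add: subtopology_subtopology) (metis Diff_subset Int_absorb1 Un_commute)
    ultimately have "openin (subtopology X (\<Union>C)) W"
      using W openin_trans_full by metis
    moreover have "x \<in> W"
      using x p disj U(2) D(4)[OF x] closedin_subset[OF closedB] by (auto simp: W_def)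
    moreover have "loop_homotopic m X x f (\<lambda>s. x)"
      if f: "f \<in> loops m X x" and im: "f ` topspace (unit_cube m) \<subseteq> W" for f
    proof -
      have fV: "f s \<in> ?V" and fU: "D (1, f s) \<in> U" if "s \<in> topspace (unit_cube m)" for s
        using im that by (auto simp: W_def)
      have "continuous_map (unit_cube m) (subtopology X ?V) f"
        using loops_continuous[OF f] fV by (auto simp: continuous_map_in_subtopology)
      from continuous_map_compose[OF continuous_map_snd this]
      have "continuous_map (prod_topology unit_interval (unit_cube m)) (subtopology X ?V) (\<lambda>z. f (snd z))"
        unfolding o_def .
      from continuous_map_pair_arg[OF D(1) continuous_map_fst this]
      \<comment> \<open>The push is stationary at \<open>x\<close>, so it moves the loop by a based
        homotopy.\<close>
      have "loop_homotopic m X x f (\<lambda>s. D (1, f s))"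
        by (rule loop_homotopicI) (simp_all add: D(2)[OF fV] D(4)[OF x] loops_boundary[OF f])
      moreover have "loop_homotopic m X x (\<lambda>s. D (1, f s)) (\<lambda>s. x)"
        by (rule U(3)[OF loop_homotopic_imp_loops(2)[OF calculation]]) (use fU in blast)
      ultimately show ?thesis by (rule loop_homotopic_trans)
    qed
    ultimately show ?thesis by blast
  qed
qed

end

section \<open>From single complexes to the product\<close>

lemma CW_infinite_sum_nullhomotopic:
  assumes "CW_complex X" and x: "x \<in> topspace X" and m: "m > 0" and f: "f \<in> null_sequences m X x"
    and null: "\<And>j. loop_homotopic m X x (f j) (\<lambda>s. x)"
  shows "loop_homotopic m X x (infinite_sum x f) (\<lambda>s. x)"
proof -
  obtain E d \<Phi> where "CW_structure X E d \<Phi>"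
    using assms(1) by (auto simp: CW_complex_def)
  then interpret cw_structure X E d \<Phi> by unfold_locales
  let ?K = "infinite_sum x f ` topspace (unit_cube m)"
  \<comment> \<open>Adjoining \<open>x\<close> puts the basepoint into the subcomplex that covers
    the image.\<close>
  have "compactin X (insert x ?K)"
  proof -
    have "compactin X ?K"
      using compact_space_unit_cube loops_continuous[OF infinite_sum_loops[OF x m f]]
      by (auto simp: compact_space_def intro: image_compactin)
    moreover have "compactin X {x}" using x by simp
    ultimately show ?thesis using compactin_Un by fastforce
  qed
  then obtain C where C: "cell_closed C" "insert x ?K \<subseteq> \<Union>C"
    by (rule compactin_cell_closed)
  then have "x \<in> \<Union>C" by blast
  from finite_subcomplex_small_loops[OF C(1) this, of m]
  obtain U where "openin (subtopology X (\<Union>C)) U \<and> x \<in> U \<and>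
    (\<forall>f\<in>loops m X x. f ` topspace (unit_cube m) \<subseteq> U \<longrightarrow> loop_homotopic m X x f (\<lambda>s. x))"
    by (elim exE)
  then have U: "openin (subtopology X (\<Union>C)) U" "x \<in> U"
    "\<And>f. f \<in> loops m X x \<Longrightarrow> f ` topspace (unit_cube m) \<subseteq> U \<Longrightarrow> loop_homotopic m X x f (\<lambda>s. x)"
    by simp_all
  obtain W where W: "openin X W" "U = W \<inter> \<Union>C"
    using U(1) by (auto simp: openin_subtopology)
  then have "\<forall>\<^sub>\<infinity>j. f j ` topspace (unit_cube m) \<subseteq> W"
    using U(2) by (intro null_sequences_eventually[OF f]) auto
  then obtain N where N: "\<And>j. j \<ge> N \<Longrightarrow> f j ` topspace (unit_cube m) \<subseteq> W"
    by (auto simp: MOST_nat_le)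
  let ?g = "\<lambda>j. if j < N then \<lambda>s. x else f j"
  have fg: "loop_homotopic m X x (infinite_sum x f) (infinite_sum x ?g)"
    using x m f null by (rule infinite_sum_replace_initial)
  have "infinite_sum x ?g ` topspace (unit_cube m) \<subseteq> W"
    using U(2) W N m by (intro infinite_sum_image) auto
  \<comment> \<open>\<open>U\<close> is open only relative to the subcomplex, so smallness alone
    gives \<open>W\<close>. The other half holds because at each point the new sum is either
    \<open>x\<close> or unchanged.\<close>
  moreover have "infinite_sum x ?g s \<in> \<Union>C" if s: "s \<in> topspace (unit_cube m)" for s
  proof (cases "s 0 = 1")
    case False
    then have "0 \<le> s 0" "s 0 < 1" using unit_cube_nth[OF s m] by auto
    then obtain j c where "\<And>x (f :: nat \<Rightarrow> (nat \<Rightarrow> real) \<Rightarrow> 'a). infinite_sum x f s = f j (s(0 := c))"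
      by (rule infinite_sum_term) blast
    then have "infinite_sum x ?g s \<in> {x, infinite_sum x f s}" by simp
    moreover have "infinite_sum x f s \<in> \<Union>C"
      by (rule subsetD[OF C(2)]) (use s in simp)
    ultimately show ?thesis using \<open>x \<in> \<Union>C\<close> by (elim insertE emptyE) simp_all
  qed (use C(2) in \<open>simp add: infinite_sum_one\<close>)
  ultimately have "loop_homotopic m X x (infinite_sum x ?g) (\<lambda>s. x)"
    unfolding W(2) by (intro U(3) loop_homotopic_imp_loops(2)[OF fg]) (use W(2) in blast)
  with fg show ?thesis by (rule loop_homotopic_trans)
qed

text \<open>Continuity into a product is tested coordinatewise, so null-homotopies chosen
  independently for all \<open>j\<close> form a single one.\<close>

lemma loop_homotopic_product:
  assumes "\<And>j. loop_homotopic m (X j) (x j) (\<lambda>s. f s j) (\<lambda>s. g s j)"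
  shows "loop_homotopic m (product_topology X UNIV) x f g"
proof -
  let ?Z = "prod_topology unit_interval (unit_cube m)"
  have "\<forall>j. \<exists>h. continuous_map ?Z (X j) h \<and> (\<forall>s\<in>topspace (unit_cube m). h (0, s) = f s j) \<and>
      (\<forall>s\<in>topspace (unit_cube m). h (1, s) = g s j) \<and> (\<forall>t\<in>{0..1}. \<forall>s\<in>cube_boundary m. h (t, s) = x j)"
    using assms by (simp add: loop_homotopic_iff)
  from choice[OF this] obtain h where h: "\<forall>j. continuous_map ?Z (X j) (h j) \<and>
      (\<forall>s\<in>topspace (unit_cube m). h j (0, s) = f s j) \<and>
      (\<forall>s\<in>topspace (unit_cube m). h j (1, s) = g s j) \<and> (\<forall>t\<in>{0..1}. \<forall>s\<in>cube_boundary m. h j (t, s) = x j)"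
    by blast
  then have "continuous_map ?Z (product_topology X UNIV) (\<lambda>z j. h j z)"
    by (simp add: continuous_map_componentwise_UNIV)
  then show ?thesis
    by (rule loop_homotopicI) (use h in \<open>auto simp: fun_eq_iff\<close>)
qed

theorem corollary4p16:
  fixes X :: "nat \<Rightarrow> 'a topology" and x :: "nat \<Rightarrow> 'a" and n :: nat
  assumes CW: "\<And>j. CW_complex (X j)"
    and base: "\<And>j. x j \<in> topspace (X j)"
    and n: "n \<ge> 2"
  shows "let G = homotopy_group (2 * n - 1) (shrinking_wedge X x) None;
             H = homotopy_group (2 * n - 1) (product_topology X UNIV) x;
             \<sigma> = induced_map (2 * n - 1) (product_topology X UNIV) x (wedge_to_product x)
         in subgroup (W_group n X x) G \<and> subgroup (kernel G H \<sigma>) G \<and>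
            W_group n X x \<subseteq> kernel G H \<sigma>"
proof -
  define m where "m = 2 * n - 1"
  define Y where "Y = shrinking_wedge X x"
  define P where "P = product_topology X UNIV"
  define S where "S = {whitehead_product n n Y None \<alpha> \<beta> | \<alpha> \<beta>. wedge_disjoint_classes n X x \<alpha> \<beta>}"
  let ?\<sigma> = "wedge_to_product x"
  \<comment> \<open>The bound \<open>m > 1\<close> provides coordinate 1, in which classes of
    infinite sums are multiplied.\<close>
  have m: "m > 1" "m > 0" and n0: "n > 0" using n by (auto simp: m_def)
  have None: "None \<in> topspace Y"
    unfolding Y_def by (rule None_in_shrinking_wedge[OF base])
  have \<sigma>: "continuous_map Y P ?\<sigma>"
    unfolding Y_def P_def by (rule continuous_map_wedge_to_product[OF base])
  have \<sigma>_None: "?\<sigma> None = x"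
    by (simp add: wedge_to_product_def wedge_retraction_None)
  interpret group_hom "homotopy_group m Y None" "homotopy_group m P x" "induced_map m P x ?\<sigma>"
    using group_hom_induced_map[OF None \<sigma> m(2)] unfolding \<sigma>_None .
  have S: "S \<subseteq> carrier (homotopy_group m Y None)"
    unfolding S_def m_def Y_def using base n0 by (rule wedge_disjoint_generate_retraction(1))
  have W_eq: "W_group n X x = infinite_sum_classes m Y None S"
    by (simp add: W_group_def S_def m_def Y_def)
  have W: "subgroup (W_group n X x) (homotopy_group m Y None)"
    unfolding W_eq using None m(1) S by (rule subgroup_infinite_sum_classes)
  have "a \<in> kernel (homotopy_group m Y None) (homotopy_group m P x) (induced_map m P x ?\<sigma>)"
    if a: "a \<in> W_group n X x" for a
  proof -
    obtain f where f: "f \<in> null_sequences m Y None"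
      "\<And>j. loop_class m Y None (f j) \<in> generate (homotopy_group m Y None) S"
      "a = loop_class m Y None (infinite_sum None f)"
      using a unfolding W_eq infinite_sum_classes_def by blast
    have sum: "infinite_sum None f \<in> loops m Y None"
      using None m(2) f(1) by (rule infinite_sum_loops)
    have "loop_homotopic m (X j) (x j) (\<lambda>s. (?\<sigma> \<circ> infinite_sum None f) s j) (\<lambda>s. x j)" for j
    proof -
      let ?r = "wedge_retraction x j"
      have r: "continuous_map Y (X j) ?r"
        unfolding Y_def by (rule continuous_map_wedge_retraction[OF base])
      have "loop_homotopic m (X j) (x j) (?r \<circ> f i) (\<lambda>s. x j)" for i
        using wedge_disjoint_generate_retraction(2)[of x X n "f i" j, OF base n0]
          null_sequences_loops[OF f(1)] f(2)[of i]
        unfolding S_def m_def Y_def by blast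
      then have "loop_homotopic m (X j) (x j) (infinite_sum (x j) (\<lambda>i. ?r \<circ> f i)) (\<lambda>s. x j)"
        using CW base m(2) null_sequences_compose[OF f(1) r None]
        by (intro CW_infinite_sum_nullhomotopic) (simp_all add: wedge_retraction_None)
      \<comment> \<open>Postcomposition commutes with infinite sums, so each coordinate of the image
        is an infinite sum in one CW-complex.\<close>
      moreover have "(\<lambda>s. (?\<sigma> \<circ> infinite_sum None f) s j) = ?r \<circ> infinite_sum None f"
        by (simp add: wedge_to_product_def o_def)
      ultimately show ?thesis
        by (simp add: compose_infinite_sum wedge_retraction_None)
    qed
    then have null: "loop_homotopic m P x (?\<sigma> \<circ> infinite_sum None f) (\<lambda>s. x)"
      unfolding P_def by (rule loop_homotopic_product)
    have "induced_map m P x ?\<sigma> a = loop_class m P x (?\<sigma> \<circ> infinite_sum None f)"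
      using induced_map_loop_class[OF sum \<sigma>] f(3) by (simp add: \<sigma>_None)
    also have "\<dots> = \<one>\<^bsub>homotopy_group m P x\<^esub>"
      using null loop_class_eq_iff[OF loop_homotopic_imp_loops(1)[OF null]] by (simp add: one_homotopy_group)
    finally show ?thesis
      using a subgroup.subset[OF W] by (auto simp: kernel_def)
  qed
  then show ?thesis
    using W subgroup_kernel unfolding Let_def m_def Y_def P_def by blast
qed

end
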